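(* In the Delsarte-dual setting of the context, assume $w_U(H)<n-1$ for every $\mathbb{F}_{q^m}$-hyperplane $H$ of $\mathbb{V}(k,q^m)$. Then: (i) if $t\in\{1,\dots,k-1\}$ satisfies $\varepsilon_U(t)>0$, then $\varepsilon_{U^d}(n-k-\varepsilon_U(t))\ge k-t>0$; (ii) let $0<\varepsilon_U(t_1)=\varepsilon_1<\dots<\varepsilon_U(t_{s-1})=\varepsilon_{s-1}<\varepsilon_U(k)=n-k$ be the sequence of maximum non-zero defects with respect to $U$. Then for every $i\in\{1,\dots,s-1\}$, $\varepsilon_{U^d}(n-k-\varepsilon_i)=k-t_i$. Moreover, for each such $i$, every $\mathbb{F}_{q^m}$-subspace $T$ of $\mathbb{V}(k,q^m)$ with $\dim T=t_i$ and $\varepsilon_U(T)=\varepsilon_i$ satisfies $\langle T\cap U\rangle=T$, $\dim_{\mathbb{F}_{q^m}}T^d=n-k-\varepsilon_i$ and $\varepsilon_{U^d}(T^d)=k-t_i$; and conversely every $\mathbb{F}_{q^m}$-subspace $X$ of $\mathbb{V}(n-k,q^m)$ with $\dim X=n-k-\varepsilon_i$ and $\varepsilon_{U^d}(X)=k-t_i$ is of the form $T^d$ for such a $T$; (iii) the sequence of maximum non-zero defects with respect to $U^d$ is $0<\varepsilon_{U^d}(n-k-\varepsilon_{s-1})=k-t_{s-1}<\varepsilon_{U^d}(n-k-\varepsilon_{s-2})=k-t_{s-2}<\dots<\varepsilon_{U^d}(n-k-\varepsilon_1)=k-t_1<\varepsilon_{U^d}(n-k)=k$; in particular it has the same length $s$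 as that of $U$.
   Context: Let $q$ be a prime power, $m$ a positive integer, $1\le k<n$. Let $\mathbb{V}(n,q^m)$ be an $n$-dim $\mathbb{F}_{q^m}$-space and $W$ an $n$-dim $\mathbb{F}_q$-subspace with $\langle W\rangle_{\mathbb{F}_{q^m}}=\mathbb{V}(n,q^m)$; $S^*=\langle S\rangle_{\mathbb{F}_{q^m}}$ for $S\subseteq W$. Let $\sigma'$ be a non-degenerate reflexive $\mathbb{F}_q$-bilinear form on $W$, $\sigma$ its $\mathbb{F}_{q^m}$-bilinear extension, $\perp$ orthogonal complement w.r.t. $\sigma$. Let $\Gamma$ be an $(n-k)$-dim $\mathbb{F}_{q^m}$-subspace with $\Gamma\cap W=\{0\}$; $\mathbb{V}(k,q^m)=\mathbb{V}(n,q^m)/\Gamma$, $U=(W+\Gamma)/\Gamma$ (so $\dim_{\mathbb{F}_q}U=n$, $\langle U\rangle=\mathbb{V}(k,q^m)$), $\mathbb{V}(n-k,q^m)=\mathbb{V}(n,q^m)/\Gamma^\perp$, $U^d=(W+\Gamma^\perp)/\Gamma^\perp$ (a Delsarte dual of $U$). For an $\mathbb{F}_q$-subspace $U$ of a $k$-dim space: $w_U(T)=\dim_{\mathbb{F}_q}(U\cap T)$, $\varepsilon_U(T)=w_U(T)-\dim_{\mathbb{F}_{q^m}}T$, and $\varepsilon_U(r)=\max\{\varepsilon_U(T):\dim_{\mathbb{F}_{q^m}}T=r\}$ for $0\le r\le k$. If $\langle U\rangle=$ the whole space and $\dim U=n$, then $0=\varepsilon_U(0)\le\varepsilon_U(1)\le\dots\le\varepsilon_U(k)=n-k$;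 letting $\varepsilon_1<\dots<\varepsilon_s$ be the distinct positive values among these and $t_i=\min\{r:\varepsilon_U(r)=\varepsilon_i\}$, the sequence $0<\varepsilon_U(t_1)<\dots<\varepsilon_U(t_s)$ is the sequence of maximum non-zero defects with respect to $U$ and $s$ its length (under the hyperplane assumption, $t_s=k$). For $T\subseteq\mathbb{V}(k,q^m)$ with $\langle T\cap U\rangle=T$: $S=\{w\in W:w+\Gamma\in T\}$ and $T^d=((S^* )^\perp+\Gamma^\perp)/\Gamma^\perp$. *)

theory Defs
  imports Complex_Main "HOL-Library.Cardinality" "HOL-Number_Theory.Prime_Powers"
begin

definition field_embedding :: "('f::field \<Rightarrow> 'l::field) \<Rightarrow> bool" where
  "field_embedding \<iota> \<longleftrightarrow>
     \<iota> 1 = 1 \<and> (\<forall>a b. \<iota> (a + b) = \<iota> a + \<iota> b) \<and> (\<forall>a b. \<iota> (a * b) = \<iota> a * \<iota> b)"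

text \<open>
  The small field is a type of its own, embedded by \<open>\<iota>\<close> into the large one. An \<open>'l\<close>-space with
  scalar multiplication \<open>s\<close> is an \<open>'f\<close>-space with scalar multiplication \<open>restrict_scalars \<iota> s\<close>.
\<close>

definition restrict_scalars :: "('f \<Rightarrow> 'l) \<Rightarrow> ('l \<Rightarrow> 'v \<Rightarrow> 'v) \<Rightarrow> 'f \<Rightarrow> 'v \<Rightarrow> 'v" where
  "restrict_scalars \<iota> s = (\<lambda>c v. s (\<iota> c) v)"

definition bilinear_form_on ::
    "('k::field \<Rightarrow> 'v::ab_group_add \<Rightarrow> 'v) \<Rightarrow> 'v set \<Rightarrow> ('v \<Rightarrow> 'v \<Rightarrow> 'k) \<Rightarrow> bool" where
  "bilinear_form_on s W B \<longleftrightarrow>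
     (\<forall>x\<in>W. \<forall>y\<in>W. \<forall>z\<in>W. B (x + y) z = B x z + B y z \<and> B x (y + z) = B x y + B x z) \<and>
     (\<forall>c. \<forall>x\<in>W. \<forall>y\<in>W. B (s c x) y = c * B x y \<and> B x (s c y) = c * B x y)"

definition reflexive_form_on :: "'v set \<Rightarrow> ('v \<Rightarrow> 'v \<Rightarrow> 'k::zero) \<Rightarrow> bool" where
  "reflexive_form_on W B \<longleftrightarrow> (\<forall>x\<in>W. \<forall>y\<in>W. B x y = 0 \<longrightarrow> B y x = 0)"

definition nondegenerate_form_on :: "'v::zero set \<Rightarrow> ('v \<Rightarrow> 'v \<Rightarrow> 'k::zero) \<Rightarrow> bool" where
  "nondegenerate_form_on W B \<longleftrightarrow>
     (\<forall>x\<in>W. (\<forall>y\<in>W. B x y = 0) \<longrightarrow> x = 0) \<and> (\<forall>y\<in>W. (\<forall>x\<in>W. B x y = 0) \<longrightarrow> y = 0)"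

definition orth_compl :: "('v \<Rightarrow> 'v \<Rightarrow> 'k::zero) \<Rightarrow> 'v set \<Rightarrow> 'v set" where
  "orth_compl B S = {v. \<forall>u\<in>S. B u v = 0}"

text \<open>
  A quotient space \<open>V / G\<close> is a space together with a canonical projection: a surjective linear
  map from \<open>V\<close> with kernel \<open>G\<close>. The cosets \<open>v + G\<close> are the values \<open>\<pi> v\<close>.
\<close>

definition quotient_map ::
    "('l::field \<Rightarrow> 'v::ab_group_add \<Rightarrow> 'v) \<Rightarrow> ('l \<Rightarrow> 'a::ab_group_add \<Rightarrow> 'a) \<Rightarrow> 'v set \<Rightarrow> ('v \<Rightarrow> 'a) \<Rightarrow> bool"
  where
  "quotient_map sV sA G \<pi> \<longleftrightarrow> Vector_Spaces.linear sV sA \<pi> \<and> surj \<pi> \<and> {v. \<pi> v = 0} = G"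

text \<open>\<open>(S + G) / G\<close>.\<close>

definition quotient_image :: "('v::ab_group_add \<Rightarrow> 'a) \<Rightarrow> 'v set \<Rightarrow> 'v set \<Rightarrow> 'a set" where
  "quotient_image \<pi> G S = \<pi> ` {x + g |x g. x \<in> S \<and> g \<in> G}"

definition weight ::
    "('f::field \<Rightarrow> 'l::field) \<Rightarrow> ('l \<Rightarrow> 'a::ab_group_add \<Rightarrow> 'a) \<Rightarrow> 'a set \<Rightarrow> 'a set \<Rightarrow> nat" where
  "weight \<iota> s U T = vector_space.dim (restrict_scalars \<iota> s) (U \<inter> T)"

definition defect ::
    "('f::field \<Rightarrow> 'l::field) \<Rightarrow> ('l \<Rightarrow> 'a::ab_group_add \<Rightarrow> 'a) \<Rightarrow> 'a set \<Rightarrow> 'a set \<Rightarrow> int" where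
  "defect \<iota> s U T = int (weight \<iota> s U T) - int (vector_space.dim s T)"

definition max_defect ::
    "('f::field \<Rightarrow> 'l::field) \<Rightarrow> ('l \<Rightarrow> 'a::ab_group_add \<Rightarrow> 'a) \<Rightarrow> 'a set \<Rightarrow> nat \<Rightarrow> int" where
  "max_defect \<iota> s U r =
     Max {defect \<iota> s U T |T. module.subspace s T \<and> vector_space.dim s T = r}"

definition nonzero_max_defects ::
    "('f::field \<Rightarrow> 'l::field) \<Rightarrow> ('l \<Rightarrow> 'a::ab_group_add \<Rightarrow> 'a) \<Rightarrow> 'a set \<Rightarrow> int set" where
  "nonzero_max_defects \<iota> s U =
     {e. 0 < e \<and> (\<exists>r \<le> vector_space.dim s UNIV. max_defect \<iota> s U r = e)}"

text \<open>
  The length \<open>s\<close>, the values \<open>\<epsilon>\<^sub>i\<close> and the positions \<open>t\<^sub>i\<close> (for \<open>1 \<le> i \<le> s\<close>) of the sequence of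
  maximum non-zero defects, and the sequence itself as the list of the pairs \<open>(t\<^sub>i, \<epsilon>\<^sub>i)\<close>, which
  stand for \<open>\<epsilon>\<^sub>U(t\<^sub>i) = \<epsilon>\<^sub>i\<close>.
\<close>

definition defect_seq_length ::
    "('f::field \<Rightarrow> 'l::field) \<Rightarrow> ('l \<Rightarrow> 'a::ab_group_add \<Rightarrow> 'a) \<Rightarrow> 'a set \<Rightarrow> nat" where
  "defect_seq_length \<iota> s U = card (nonzero_max_defects \<iota> s U)"

definition defect_seq_val ::
    "('f::field \<Rightarrow> 'l::field) \<Rightarrow> ('l \<Rightarrow> 'a::ab_group_add \<Rightarrow> 'a) \<Rightarrow> 'a set \<Rightarrow> nat \<Rightarrow> int" where
  "defect_seq_val \<iota> s U i = sorted_list_of_set (nonzero_max_defects \<iota> s U) ! (i - 1)"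

definition defect_seq_pos ::
    "('f::field \<Rightarrow> 'l::field) \<Rightarrow> ('l \<Rightarrow> 'a::ab_group_add \<Rightarrow> 'a) \<Rightarrow> 'a set \<Rightarrow> nat \<Rightarrow> nat" where
  "defect_seq_pos \<iota> s U i =
     (LEAST r. r \<le> vector_space.dim s UNIV \<and> max_defect \<iota> s U r = defect_seq_val \<iota> s U i)"

definition defect_seq ::
    "('f::field \<Rightarrow> 'l::field) \<Rightarrow> ('l \<Rightarrow> 'a::ab_group_add \<Rightarrow> 'a) \<Rightarrow> 'a set \<Rightarrow> (nat \<times> int) list" where
  "defect_seq \<iota> s U =
     map (\<lambda>i. (defect_seq_pos \<iota> s U i, defect_seq_val \<iota> s U i)) [1..<defect_seq_length \<iota> s U + 1]"

text \<open>
  \<open>T\<^sup>d = ((S\<^sup>*)\<^sup>\<bottom> + \<Gamma>\<^sup>\<bottom>) / \<Gamma>\<^sup>\<bottom>\<close> where \<open>S = {w \<in> W. w + \<Gamma> \<in> T}\<close>, with \<open>\<pi>\<close> the projection onto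
  \<open>V / \<Gamma>\<close> and \<open>\<rho>\<close> the projection onto \<open>V / \<Gamma>\<^sup>\<bottom>\<close>.
\<close>

definition dual_subspace ::
    "('l::field \<Rightarrow> 'v::ab_group_add \<Rightarrow> 'v) \<Rightarrow> ('v \<Rightarrow> 'v \<Rightarrow> 'l) \<Rightarrow> 'v set \<Rightarrow> 'v set \<Rightarrow>
     ('v \<Rightarrow> 'a) \<Rightarrow> ('v \<Rightarrow> 'b) \<Rightarrow> 'a set \<Rightarrow> 'b set" where
  "dual_subspace sV \<sigma> W \<Gamma> \<pi> \<rho> T =
     quotient_image \<rho> (orth_compl \<sigma> \<Gamma>)
       (orth_compl \<sigma> (module.span sV {w \<in> W. \<pi> w \<in> T}))"

end

theory Submission
  imports Defs
begin

text \<open>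
  Write \<open>S\<^sup>*\<close> for the \<open>'l\<close>-span of an \<open>'f\<close>-subspace \<open>S\<close> of \<open>W\<close>. Then
  \<open>dim S = dim (S\<^sup>* \<inter> \<Gamma>) + dim \<pi>(S\<^sup>*)\<close>, and passing to \<open>S\<^sup>\<bottom> \<inter> W\<close>, whose span is \<open>(S\<^sup>*)\<^sup>\<bottom>\<close>, turns the
  pair \<open>(dim \<pi>(S\<^sup>*), dim (S\<^sup>* \<inter> \<Gamma>)) = (r, e)\<close> into \<open>(n - k - e, k - r)\<close> with respect to \<open>\<Gamma>\<^sup>\<bottom>\<close>.
  A subspace of maximum defect for its dimension is spanned by its vectors in \<open>U\<close>, hence has the
  form \<open>\<pi>(S\<^sup>*)\<close> with defect \<open>dim (S\<^sup>* \<inter> \<Gamma>)\<close>. So the maximum defects \<open>f\<close> of \<open>U\<close> and \<open>g\<close> of \<open>U\<^sup>d\<close>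
  satisfy \<open>g (n - k - f r) \<ge> k - r\<close> and \<open>f (k - g x) \<ge> n - k - x\<close>. This is a Galois connection
  between two monotone step functions, and it exchanges their jump positions and jump values.

  The hyperplane assumption yields \<open>\<Gamma>\<^sup>\<bottom> \<inter> W = 0\<close> and \<open>f (k - 1) < n - k\<close>. The way back
  from \<open>U\<^sup>d\<close> to \<open>U\<close> uses the flipped form, whose complements invert those of the original form.
\<close>

section \<open>Dimension counts\<close>

context vector_space
begin

lemma finite_dimensionalI:
  assumes "finite (UNIV :: 'b set)"
  obtains B where "finite_dimensional_vector_space scale B"
proof -
  obtain B where B: "independent B" "UNIV \<subseteq> span B"
    using maximal_independent_subset[of UNIV] by blast
  have "finite_dimensional_vector_space scale B"
    using B finite_subset[OF subset_UNIV assms] by unfold_locales auto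
  then show thesis by (rule that)
qed

text \<open>Finiteness of the space makes it finite-dimensional over the small field as well as over
  the large one. Each further spanning vector contributes only finitely many multiples.\<close>

lemma finite_UNIV_if_finite_spanning:
  assumes "finite (UNIV :: 'a set)" "finite B" "span B = UNIV"
  shows "finite (UNIV :: 'b set)"
proof -
  have "finite (span A)" if "finite A" for A
    using that
  proof (induction A rule: finite_induct)
    case (insert a A)
    have "span (insert a A) \<subseteq> (\<lambda>(c, x). scale c a + x) ` (UNIV \<times> span A)"
    proof
      fix x assume "x \<in> span (insert a A)"
      then obtain c where "x - scale c a \<in> span A"
        using span_breakdown_eq by blast
      then show "x \<in> (\<lambda>(c, x). scale c a + x) ` (UNIV \<times> span A)"
        by (intro image_eqI[of _ _ "(c, x - scale c a)"]) auto
    qed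
    then show ?case
      using insert assms(1) by (meson finite_SigmaI finite_imageI finite_subset)
  qed auto
  from this[OF assms(2)] show ?thesis by (simp add: assms(3))
qed

end

context finite_dimensional_vector_space
begin

text \<open>Linearity is required on \<open>Y\<close> alone because \<open>\<sigma>'\<close> is
  bilinear only on \<open>W\<close>. One vector outside the kernel spans \<open>Y\<close> together
  with it.\<close>

lemma dim_le_dim_kernel_Suc:
  assumes Y: "subspace Y"
    and add: "\<And>x y. x \<in> Y \<Longrightarrow> y \<in> Y \<Longrightarrow> \<phi> (x + y) = \<phi> x + \<phi> y"
    and hom: "\<And>c x. x \<in> Y \<Longrightarrow> \<phi> (scale c x) = c * \<phi> x"
  shows "dim Y \<le> dim {y \<in> Y. \<phi> y = 0} + 1"
proof (cases "\<forall>y\<in>Y. \<phi> y = 0")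
  case True
  then have "{y \<in> Y. \<phi> y = 0} = Y" by auto
  then show ?thesis by simp
next
  case False
  then obtain y0 where y0: "y0 \<in> Y" "\<phi> y0 \<noteq> 0" by auto
  let ?K = "{y \<in> Y. \<phi> y = 0}"
  have "Y \<subseteq> span (insert y0 ?K)"
  proof
    fix y assume y: "y \<in> Y"
    let ?c = "\<phi> y / \<phi> y0"
    let ?z = "y + scale (- ?c) y0"
    have z: "scale (- ?c) y0 \<in> Y" using Y y0 subspace_scale by blast
    have "?z \<in> Y" using z y Y subspace_add by blast
    moreover have "\<phi> ?z = 0"
      using add[OF y z] hom[OF y0(1), of "- ?c"] y0 by simp
    ultimately have "y - scale ?c y0 \<in> span ?K" by (simp add: span_base)
    then show "y \<in> span (insert y0 ?K)" using span_breakdown_eq by blast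
  qed
  then have "dim Y \<le> dim (insert y0 ?K)" by (rule dim_mono)
  also have "\<dots> \<le> dim ?K + 1" by (simp add: dim_insert)
  finally show ?thesis .
qed

text \<open>Each vector of \<open>C\<close> imposes one linear condition. The bound serves both
  \<open>\<sigma>'\<close> on \<open>W\<close> over the small field and \<open>\<sigma>\<close> on
  the whole space over the large one.\<close>

lemma dim_le_dim_annihilator:
  assumes Y: "subspace Y" "Y \<subseteq> W" and W: "bilinear_form_on scale W B" and "subspace W"
    and C: "finite C" "C \<subseteq> W"
  shows "dim Y \<le> dim {y \<in> Y. \<forall>c\<in>C. B c y = 0} + card C"
  using C
proof (induction C rule: finite_induct)
  case (insert c C)
  let ?K = "{y \<in> Y. \<forall>c\<in>C. B c y = 0}"
  have cW: "c \<in> W" "C \<subseteq> W" using insert by auto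
  have B0: "B d 0 = 0" if "d \<in> W" for d
    using W that \<open>subspace W\<close> subspace_0
    unfolding bilinear_form_on_def by (metis add_cancel_right_right)
  have badd: "B d (x + y) = B d x + B d y" if "d \<in> W" "x \<in> Y" "y \<in> Y" for d x y
    using W Y that unfolding bilinear_form_on_def by blast
  have bhom: "B d (scale a x) = a * B d x" if "d \<in> W" "x \<in> Y" for d x a
    using W Y that unfolding bilinear_form_on_def by blast
  have K: "subspace ?K"
    using Y(1) B0 badd bhom cW(2) unfolding subspace_def by (auto simp: subset_iff)
  have "dim ?K \<le> dim {y \<in> ?K. B c y = 0} + 1"
    by (rule dim_le_dim_kernel_Suc[OF K]) (use badd bhom cW in auto)
  moreover have "{y \<in> ?K. B c y = 0} = {y \<in> Y. \<forall>d\<in>insert c C. B d y = 0}" by auto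
  ultimately show ?case using insert cW by simp
qed simp

end

lemma bilinear_form_on_flip:
  "bilinear_form_on s W B \<Longrightarrow> bilinear_form_on s W (\<lambda>x y. B y x)"
  unfolding bilinear_form_on_def by blast

context finite_dimensional_vector_space_pair_1
begin

text \<open>Rank-nullity on a subspace: a basis \<open>C\<close> of the kernel part extends to a
  basis \<open>D\<close> of \<open>Y\<close>, and \<open>f\<close> is injective on the span of
  \<open>D - C\<close>.\<close>

lemma dim_image_add_dim_kernel:
  assumes lin: "Vector_Spaces.linear s1 s2 f" and Y: "vs1.subspace Y"
  shows "vs2.dim (f ` Y) + vs1.dim (Y \<inter> {x. f x = 0}) = vs1.dim Y"
proof -
  interpret f: Vector_Spaces.linear s1 s2 f by fact
  let ?K = "Y \<inter> {x. f x = 0}"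
  have K: "vs1.subspace ?K" using Y f.subspace_kernel vs1.subspace_inter by blast
  obtain C where C: "finite C" "C \<subseteq> ?K" "vs1.independent C" "vs1.span C = ?K" "card C = vs1.dim ?K"
    using vs1.basis_subspace_exists[OF K] .
  obtain D where D: "C \<subseteq> D" "D \<subseteq> Y" "vs1.independent D" "Y \<subseteq> vs1.span D"
    using vs1.maximal_independent_subset_extend[of C Y] C by blast
  have spD: "vs1.span D = Y" using D Y vs1.span_minimal by blast
  have finD: "finite D" using D vs1.finiteI_independent by blast
  have indE: "vs1.independent (D - C)" using D vs1.independent_mono by blast
  have Y_eq: "Y = {x + y |x y. x \<in> vs1.span C \<and> y \<in> vs1.span (D - C)}"
    using vs1.span_Un[of C "D - C"] D(1) spD by (simp add: Un_absorb1)
  have dims: "vs1.dim Y = card C + card (D - C)"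
    using D finD C vs1.dim_span_eq_card_independent[OF D(3)] spD
    by (metis card_Diff_subset card_mono le_add_diff_inverse)
  have "vs1.dim Y + vs1.dim (vs1.span C \<inter> vs1.span (D - C)) = card C + card (D - C)"
    using vs1.dim_sums_Int[OF vs1.subspace_span vs1.subspace_span, of C "D - C"] Y_eq
      vs1.dim_span_eq_card_independent[OF indE] vs1.dim_span_eq_card_independent[OF C(3)]
    by simp
  then have "vs1.dim (vs1.span C \<inter> vs1.span (D - C)) = 0" using dims by simp
  then have triv: "vs1.span C \<inter> vs1.span (D - C) \<subseteq> {0}"
    by simp
  have "f ` Y = f ` vs1.span (D - C)"
  proof
    show "f ` Y \<subseteq> f ` vs1.span (D - C)"
    proof
      fix z assume "z \<in> f ` Y"
      then obtain x y where "x \<in> vs1.span C" and y: "y \<in> vs1.span (D - C)" and z: "z = f (x + y)"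
        using Y_eq by auto
      then have "f x = 0" using C by auto
      then show "z \<in> f ` vs1.span (D - C)" using y z by (simp add: f.add)
    qed
    show "f ` vs1.span (D - C) \<subseteq> f ` Y"
      using spD vs1.span_mono[of "D - C" D] by blast
  qed
  moreover have "inj_on f (vs1.span (D - C))"
    unfolding f.inj_on_iff_eq_0[OF vs1.subspace_span]
  proof (intro ballI impI)
    fix x assume x: "x \<in> vs1.span (D - C)" "f x = 0"
    then have "x \<in> ?K" using spD vs1.span_mono[of "D - C" D] by blast
    then show "x = 0" using x C triv by blast
  qed
  ultimately have "vs2.dim (f ` Y) = card (D - C)"
    using dim_image_eq[OF lin, of "vs1.span (D - C)"] indE vs1.dim_span_eq_card_independent
    by (simp add: vs1.span_span)
  then show ?thesis using dims C by simp
qed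

end

section \<open>Subgeometries and their forms\<close>

locale extension_space =
  L: finite_dimensional_vector_space sV BL +
  F: finite_dimensional_vector_space "restrict_scalars \<iota> sV" BF
  for \<iota> :: "'f::field \<Rightarrow> 'l::field" and sV :: "'l \<Rightarrow> 'v::ab_group_add \<Rightarrow> 'v" and BL BF
begin

lemma subspace_restrict_scalars: "L.subspace X \<Longrightarrow> F.subspace X"
  unfolding L.subspace_def F.subspace_def by (simp add: restrict_scalars_def)

lemma span_restrict_scalars_subset: "F.span X \<subseteq> L.span X"
  by (simp add: F.span_minimal L.span_superset subspace_restrict_scalars)

end

locale subgeometry = extension_space \<iota> sV BL BF
  for \<iota> :: "'f::field \<Rightarrow> 'l::field" and sV :: "'l \<Rightarrow> 'v::ab_group_add \<Rightarrow> 'v" and BL BF +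
  fixes W :: "'v set"
  assumes subspace_W: "F.subspace W"
    and span_W: "L.span W = UNIV"
    and dim_W: "F.dim W = L.dim UNIV"
begin

text \<open>\<open>C\<close> spans the whole space over the large field and has as many elements as
  its dimension, so it is independent there.\<close>

lemma basis_W_independent:
  assumes C: "C \<subseteq> W" "W \<subseteq> F.span C" "F.independent C"
  shows "L.independent C" "L.span C = UNIV"
proof -
  have "W \<subseteq> L.span C" using C span_restrict_scalars_subset by blast
  then show sp: "L.span C = UNIV"
    using span_W L.span_minimal[OF _ L.subspace_span] by blast
  have "card C = L.dim UNIV" using F.basis_card_eq_dim[OF C] dim_W by simp
  then show "L.independent C"
    using L.card_le_dim_spanning[of C UNIV] sp F.finiteI_independent[OF C(3)] by simp
qed

text \<open>A basis of \<open>S\<close> over the small field extends to one of \<open>W\<close>,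
  hence stays independent over the large field.\<close>

lemma dim_rational:
  assumes S: "F.subspace S" "S \<subseteq> W"
  shows "L.dim S = F.dim S"
proof -
  obtain C where C: "C \<subseteq> S" "F.independent C" "F.span C = S" "card C = F.dim S"
    using F.basis_subspace_exists[OF S(1)] .
  obtain D where D: "C \<subseteq> D" "D \<subseteq> W" "F.independent D" "W \<subseteq> F.span D"
    using F.maximal_independent_subset_extend[of C W] C S by blast
  have "L.independent C" using basis_W_independent(1)[OF D(2,4,3)] D(1) L.independent_mono by blast
  moreover have "S \<subseteq> L.span C" using C span_restrict_scalars_subset by blast
  ultimately show ?thesis using L.basis_card_eq_dim C by metis
qed

end

section \<open>Orthogonal complements for the extended form\<close>

locale subgeometry_form = subgeometry \<iota> sV BL BF W
  for \<iota> :: "'f::field \<Rightarrow> 'l::field" and sV :: "'l \<Rightarrow> 'v::ab_group_add \<Rightarrow> 'v" and BL BF W +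
  fixes \<sigma>' :: "'v \<Rightarrow> 'v \<Rightarrow> 'f" and \<sigma> :: "'v \<Rightarrow> 'v \<Rightarrow> 'l"
  assumes embedding: "field_embedding \<iota>"
    and form_W: "bilinear_form_on (restrict_scalars \<iota> sV) W \<sigma>'"
    and nondegenerate: "nondegenerate_form_on W \<sigma>'"
    and form: "bilinear_form_on sV UNIV \<sigma>"
    and form_extends: "\<And>x y. x \<in> W \<Longrightarrow> y \<in> W \<Longrightarrow> \<sigma> x y = \<iota> (\<sigma>' x y)"
begin

text \<open>Left complements for \<open>\<sigma>\<close> are right complements for the flipped form,
  so every fact on \<open>orth_compl\<close> becomes available on both sides.\<close>

lemma flip: "subgeometry_form \<iota> sV BL BF W (\<lambda>x y. \<sigma>' y x) (\<lambda>x y. \<sigma> y x)"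
proof unfold_locales
  show "nondegenerate_form_on W (\<lambda>x y. \<sigma>' y x)"
    using nondegenerate unfolding nondegenerate_form_on_def by blast
qed (use embedding form_W form form_extends bilinear_form_on_flip in auto)

lemma embedding_0: "\<iota> 0 = 0"
  using embedding unfolding field_embedding_def by (metis add_cancel_right_right)

lemma embedding_eq_0_iff: "\<iota> a = 0 \<longleftrightarrow> a = 0"
proof
  assume a: "\<iota> a = 0"
  show "a = 0"
  proof (rule ccontr)
    assume "a \<noteq> 0"
    then have "\<iota> a * \<iota> (inverse a) = 1"
      using embedding unfolding field_embedding_def by (metis right_inverse)
    then show False using a by simp
  qed
qed (simp add: embedding_0)

lemma form_add_right: "\<sigma> x (y + z) = \<sigma> x y + \<sigma> x z"
  and form_add_left: "\<sigma> (x + y) z = \<sigma> x z + \<sigma> y z"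
  and form_scale_right: "\<sigma> x (sV c y) = c * \<sigma> x y"
  and form_scale_left: "\<sigma> (sV c x) y = c * \<sigma> x y"
  using form unfolding bilinear_form_on_def by blast+

lemma form_0_left: "\<sigma> 0 y = 0" and form_0_right: "\<sigma> x 0 = 0"
  using form_scale_left[of 0 0 y] form_scale_right[of x 0 0] by simp_all

lemma form_sum_right: "\<sigma> x (\<Sum>i\<in>I. g i) = (\<Sum>i\<in>I. \<sigma> x (g i))"
  by (induction I rule: infinite_finite_induct) (simp_all add: form_0_right form_add_right)

lemma subspace_orth_compl: "L.subspace (orth_compl \<sigma> X)"
  unfolding L.subspace_def orth_compl_def
  by (simp add: form_0_right form_add_right form_scale_right)

lemma orth_compl_span: "orth_compl \<sigma> (L.span X) = orth_compl \<sigma> X"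
proof
  show "orth_compl \<sigma> (L.span X) \<subseteq> orth_compl \<sigma> X"
    using L.span_superset unfolding orth_compl_def by auto
  show "orth_compl \<sigma> X \<subseteq> orth_compl \<sigma> (L.span X)"
  proof
    fix v assume v: "v \<in> orth_compl \<sigma> X"
    have "L.subspace {u. \<sigma> u v = 0}"
      unfolding L.subspace_def by (simp add: form_0_left form_add_left form_scale_left)
    then have "L.span X \<subseteq> {u. \<sigma> u v = 0}"
      using v by (intro L.span_minimal) (auto simp: orth_compl_def)
    then show "v \<in> orth_compl \<sigma> (L.span X)" by (auto simp: orth_compl_def)
  qed
qed

lemma dim_rational_annihilator:
  assumes S: "F.subspace S" "S \<subseteq> W"
  shows "F.dim W \<le> F.dim {w \<in> W. \<forall>x\<in>S. \<sigma>' x w = 0} + F.dim S"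
proof -
  obtain C where C: "finite C" "C \<subseteq> S" "F.independent C" "F.span C = S" "card C = F.dim S"
    using F.basis_subspace_exists[OF S(1)] .
  have "F.dim W \<le> F.dim {w \<in> W. \<forall>c\<in>C. \<sigma>' c w = 0} + card C"
    by (rule F.dim_le_dim_annihilator[OF subspace_W order_refl form_W subspace_W])
      (use C S in auto)
  moreover have "{w \<in> W. \<forall>c\<in>C. \<sigma>' c w = 0} = {w \<in> W. \<forall>x\<in>S. \<sigma>' x w = 0}"
  proof -
    have "\<sigma>' x w = 0" if w: "w \<in> W" "\<forall>c\<in>C. \<sigma>' c w = 0" and x: "x \<in> S" for w x
    proof -
      \<comment> \<open>The kernel is taken with \<open>\<sigma>\<close>, which is bilinear
        everywhere; on \<open>W\<close> it vanishes exactly where \<open>\<sigma>'\<close>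
        does.\<close>
      have "F.subspace {u \<in> W. \<sigma> u w = 0}"
        using subspace_W unfolding F.subspace_def
        by (auto simp: form_0_left form_add_left form_scale_left restrict_scalars_def)
      then have "F.span C \<subseteq> {u \<in> W. \<sigma> u w = 0}"
        by (rule F.span_minimal[rotated])
          (use w C S in \<open>auto simp: form_extends embedding_eq_0_iff subset_iff\<close>)
      then have "x \<in> W" "\<sigma> x w = 0" using x C by auto
      then show ?thesis using form_extends[of x w] w embedding_eq_0_iff by simp
    qed
    then show ?thesis using C by blast
  qed
  ultimately show ?thesis using C by simp
qed

end

text \<open>
  The extension stays non-degenerate because every vector of an \<open>'f\<close>-basis of \<open>W\<close> can be
  separated from the others by a vector of \<open>W\<close>.
\<close>

lemma (in subgeometry_form) orth_compl_W: "orth_compl \<sigma> W = {0}"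
proof -
  interpret flip: subgeometry_form \<iota> sV BL BF W "\<lambda>x y. \<sigma>' y x" "\<lambda>x y. \<sigma> y x"
    by (rule flip)
  obtain C where C: "finite C" "C \<subseteq> W" "F.independent C" "F.span C = W" "card C = F.dim W"
    using F.basis_subspace_exists[OF subspace_W] .
  have indC: "L.independent C" "L.span C = UNIV"
    using basis_W_independent[of C] C by auto
  have "v = 0" if v: "v \<in> orth_compl \<sigma> W" for v
  proof -
    obtain u where u: "v = (\<Sum>c\<in>C. sV (u c) c)"
      using L.span_finite[OF C(1)] indC by (metis (no_types, lifting) UNIV_I imageE)
    have "u b = 0" if b: "b \<in> C" for b
    proof -
      \<comment> \<open>\<open>?S\<close> has codimension one in \<open>W\<close>, so a dimension
        count yields a nonzero \<open>w\<close> in \<open>W\<close> orthogonal to every basis vector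
        except possibly \<open>b\<close>.\<close>
      let ?S = "F.span (C - {b})"
      let ?K = "{w \<in> W. \<forall>x\<in>?S. \<sigma>' w x = 0}"
      have S: "F.subspace ?S" "?S \<subseteq> W" using C F.span_mono[of "C - {b}" C] by auto
      have "F.dim ?S = card (C - {b})"
        using F.dim_span_eq_card_independent F.independent_mono[OF C(3)] by blast
      also have "\<dots> < F.dim W" using C b by (metis card_Diff1_less)
      finally have "F.dim ?K \<noteq> 0" using flip.dim_rational_annihilator[OF S] by linarith
      then have "\<not> ?K \<subseteq> {0}" by simp
      then obtain w where w: "w \<in> W" "w \<noteq> 0" "\<And>x. x \<in> ?S \<Longrightarrow> \<sigma>' w x = 0" by blast
      have w0: "\<sigma> w c = 0" if "c \<in> C - {b}" for c
        using w that C F.span_base[OF that] form_extends[of w c] embedding_0 by auto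
      \<comment> \<open>If \<open>w\<close> were orthogonal to \<open>b\<close> as well, it would be
        orthogonal to everything, against the non-degeneracy of \<open>\<sigma>'\<close>.\<close>
      have wb: "\<sigma> w b \<noteq> 0"
      proof
        assume "\<sigma> w b = 0"
        then have "C \<subseteq> {v. \<sigma> w v = 0}" using w0 by auto
        moreover have "L.subspace {v. \<sigma> w v = 0}"
          unfolding L.subspace_def by (simp add: form_0_right form_add_right form_scale_right)
        ultimately have "\<sigma> w y = 0" for y
          using indC(2) L.span_minimal by blast
        then have "\<forall>y\<in>W. \<sigma>' w y = 0" using w form_extends embedding_eq_0_iff by metis
        then show False using nondegenerate w unfolding nondegenerate_form_on_def by blast
      qed
      have "0 = \<sigma> w v" using v w by (auto simp: orth_compl_def)
      also have "\<dots> = (\<Sum>c\<in>C. u c * \<sigma> w c)" by (simp add: u form_sum_right form_scale_right)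
      also have "\<dots> = u b * \<sigma> w b + (\<Sum>c\<in>C - {b}. u c * \<sigma> w c)"
        using C b by (simp add: sum.remove)
      also have "\<dots> = u b * \<sigma> w b" using w0 by simp
      finally show ?thesis using wb by simp
    qed
    then show "v = 0" by (simp add: u)
  qed
  then show ?thesis using L.subspace_0[OF subspace_orth_compl] by blast
qed

context subgeometry_form
begin

text \<open>Annihilating a basis of \<open>X\<close> costs at most \<open>dim X\<close> dimensions.
  Conversely, completing that basis to one of the whole space adds codimension many conditions,
  after which only 0 remains by \<open>orth_compl_W\<close>.\<close>

lemma dim_orth_compl: "L.dim (orth_compl \<sigma> X) + L.dim X = L.dim UNIV"
proof -
  obtain C where C: "finite C" "C \<subseteq> L.span X" "L.independent C" "L.span C = L.span X" "card C = L.dim (L.span X)"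
    using L.basis_subspace_exists[OF L.subspace_span] .
  obtain D where D: "C \<subseteq> D" "L.independent D" "UNIV \<subseteq> L.span D"
    using L.maximal_independent_subset_extend[OF subset_UNIV C(3)] by metis
  have finD: "finite D" using D L.finiteI_independent by blast
  have cardD: "card D = L.dim UNIV" using L.basis_card_eq_dim D by blast
  have XC: "orth_compl \<sigma> X = orth_compl \<sigma> C" using C(4) orth_compl_span by metis
  have "L.dim UNIV \<le> L.dim {y \<in> UNIV. \<forall>c\<in>C. \<sigma> c y = 0} + card C"
    by (rule L.dim_le_dim_annihilator[OF _ _ form]) (use C in auto)
  then have ge: "L.dim UNIV \<le> L.dim (orth_compl \<sigma> X) + L.dim X"
    using C XC by (simp add: orth_compl_def)
  have "L.dim (orth_compl \<sigma> X) \<le> L.dim {y \<in> orth_compl \<sigma> X. \<forall>c\<in>D - C. \<sigma> c y = 0} + card (D - C)"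
    by (rule L.dim_le_dim_annihilator[OF subspace_orth_compl _ form]) (use finD in auto)
  moreover have "{y \<in> orth_compl \<sigma> X. \<forall>c\<in>D - C. \<sigma> c y = 0} = orth_compl \<sigma> D"
    using XC D(1) by (auto simp: orth_compl_def)
  moreover have "orth_compl \<sigma> D = {0}"
    using D(3) orth_compl_W orth_compl_span[of D] orth_compl_span[of W] span_W by (simp add: top.extremum_unique)
  moreover have "card (D - C) + L.dim X = L.dim UNIV"
    using D(1) finD C cardD by (metis L.dim_span card_Diff_subset card_mono le_add_diff_inverse2)
  ultimately show ?thesis using ge by simp
qed

text \<open>Counting over the small field bounds the dimension of
  \<open>W \<inter> orth_compl \<sigma> S\<close> from below, and the complement over the large
  field bounds it from above. The bounds agree, so the vectors in \<open>W\<close> span the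
  complement.\<close>

lemma orth_compl_rational:
  assumes S: "F.subspace S" "S \<subseteq> W"
  shows "F.subspace (W \<inter> orth_compl \<sigma> S)"
    and "F.dim (W \<inter> orth_compl \<sigma> S) + F.dim S = F.dim W"
    and "L.span (W \<inter> orth_compl \<sigma> S) = orth_compl \<sigma> S"
proof -
  let ?R = "W \<inter> orth_compl \<sigma> S"
  show R: "F.subspace ?R"
    using F.subspace_inter subspace_W subspace_restrict_scalars subspace_orth_compl by blast
  have "?R = {w \<in> W. \<forall>x\<in>S. \<sigma>' x w = 0}"
    using S form_extends embedding_eq_0_iff by (auto simp: orth_compl_def subset_iff)
  then have ge: "F.dim W \<le> F.dim ?R + F.dim S"
    using dim_rational_annihilator[OF S] by simp
  have sub: "L.span ?R \<subseteq> orth_compl \<sigma> S"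
    using L.span_minimal subspace_orth_compl by blast
  then have le: "F.dim ?R \<le> L.dim (orth_compl \<sigma> S)"
    using L.dim_subset[OF sub] dim_rational[OF R] by simp
  have eq: "L.dim (orth_compl \<sigma> S) + F.dim S = F.dim W"
    using dim_orth_compl[of S] dim_rational[OF S] dim_W by simp
  show "F.dim ?R + F.dim S = F.dim W" using ge le eq by linarith
  then have "L.dim (orth_compl \<sigma> S) \<le> L.dim (L.span ?R)"
    using eq dim_rational[OF R] by simp
  then show "L.span ?R = orth_compl \<sigma> S"
    using L.subspace_dim_equal[OF L.subspace_span subspace_orth_compl sub] by simp
qed

lemma orth_compl_sums:
  assumes "L.subspace X" "L.subspace Y"
  shows "orth_compl \<sigma> {x + y |x y. x \<in> X \<and> y \<in> Y} = orth_compl \<sigma> X \<inter> orth_compl \<sigma> Y"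
proof -
  have "{x + y |x y. x \<in> X \<and> y \<in> Y} = L.span (X \<union> Y)"
    using assms by (simp add: L.span_Un L.span_eq_iff[THEN iffD2])
  then show ?thesis by (simp only: orth_compl_span) (auto simp: orth_compl_def)
qed

end

text \<open>Taking the second complement on the opposite side makes the inclusion of
  \<open>X\<close> immediate; the dimension formula on both sides gives equality.\<close>

lemma (in subgeometry_form) orth_compl_orth_compl:
  assumes "L.subspace X"
  shows "orth_compl (\<lambda>x y. \<sigma> y x) (orth_compl \<sigma> X) = X"
proof -
  interpret flip: subgeometry_form \<iota> sV BL BF W "\<lambda>x y. \<sigma>' y x" "\<lambda>x y. \<sigma> y x"
    by (rule flip)
  let ?Y = "orth_compl (\<lambda>x y. \<sigma> y x) (orth_compl \<sigma> X)"
  have "X \<subseteq> ?Y" by (auto simp: orth_compl_def)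
  moreover have "L.dim ?Y \<le> L.dim X"
    using flip.dim_orth_compl[of "orth_compl \<sigma> X"] dim_orth_compl[of X] by simp
  ultimately show ?thesis
    using L.subspace_dim_equal[OF assms flip.subspace_orth_compl] by metis
qed

section \<open>Defects in a quotient\<close>

locale linear_set = subgeometry \<iota> sV BL BF W + A: extension_space \<iota> sA AL AF
  for \<iota> :: "'f::field \<Rightarrow> 'l::field" and sV :: "'l \<Rightarrow> 'v::ab_group_add \<Rightarrow> 'v" and BL BF W
    and sA :: "'l \<Rightarrow> 'a::ab_group_add \<Rightarrow> 'a" and AL AF +
  fixes \<Gamma> :: "'v set" and \<pi> :: "'v \<Rightarrow> 'a"
  assumes quotient: "quotient_map sV sA \<Gamma> \<pi>"
    and Gamma_Int_W: "\<Gamma> \<inter> W = {0}"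
begin

abbreviation "U \<equiv> quotient_image \<pi> \<Gamma> W"

sublocale pi: Vector_Spaces.linear sV sA \<pi>
  using quotient unfolding quotient_map_def by simp

sublocale piF: Vector_Spaces.linear "restrict_scalars \<iota> sV" "restrict_scalars \<iota> sA" \<pi>
  by unfold_locales (simp_all add: pi.add restrict_scalars_def pi.scale)

lemma surj_pi: "surj \<pi>" and kernel_pi: "\<pi> v = 0 \<longleftrightarrow> v \<in> \<Gamma>"
  using quotient unfolding quotient_map_def by auto

lemma quotient_image_eq: "S \<noteq> {} \<Longrightarrow> quotient_image \<pi> \<Gamma> S = \<pi> ` S"
proof -
  have "0 \<in> \<Gamma>" using kernel_pi[of 0] pi.zero by simp
  moreover have "\<pi> (x + g) = \<pi> x" if "g \<in> \<Gamma>" for x g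
    using that kernel_pi[of g] by (simp add: pi.add)
  ultimately show ?thesis
    unfolding quotient_image_def by (auto simp: image_iff) (metis add_0_right)
qed

lemma U_eq: "U = \<pi> ` W"
  using quotient_image_eq[of W] F.subspace_0[OF subspace_W] by blast

lemma subspace_Gamma: "L.subspace \<Gamma>"
  using pi.subspace_kernel by (simp add: kernel_pi)

lemma dim_image_pi:
  assumes "L.subspace Y"
  shows "A.L.dim (\<pi> ` Y) + L.dim (Y \<inter> \<Gamma>) = L.dim Y"
proof -
  interpret pair: finite_dimensional_vector_space_pair_1 sV BL sA by unfold_locales
  show ?thesis
    using pair.dim_image_add_dim_kernel[OF pi.linear_axioms assms] by (simp add: kernel_pi)
qed

lemma dim_vimage_pi:
  assumes "A.L.subspace T"
  shows "A.L.dim T + L.dim \<Gamma> = L.dim (\<pi> -` T)"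
proof -
  have "\<pi> ` (\<pi> -` T) = T" using surj_pi by (simp add: surj_image_vimage_eq)
  moreover have "\<pi> -` T \<inter> \<Gamma> = \<Gamma>"
    using A.L.subspace_0[OF assms] by (auto simp flip: kernel_pi)
  ultimately show ?thesis
    using dim_image_pi[OF pi.subspace_vimage[OF assms]] by simp
qed

lemma dim_A: "A.L.dim UNIV + L.dim \<Gamma> = L.dim UNIV"
  using dim_vimage_pi[OF A.L.subspace_UNIV] by simp

lemma subspace_W_Int_vimage: "A.L.subspace T \<Longrightarrow> F.subspace (W \<inter> \<pi> -` T)"
  using F.subspace_inter subspace_W subspace_restrict_scalars pi.subspace_vimage by blast

text \<open>\<open>\<pi>\<close> is injective on \<open>W\<close> because \<open>\<Gamma>\<close>
  meets \<open>W\<close> trivially, so weights in the quotient can be computed inside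
  \<open>W\<close>.\<close>

lemma weight_eq:
  assumes "A.L.subspace T"
  shows "weight \<iota> sA U T = F.dim (W \<inter> \<pi> -` T)"
proof -
  interpret pair: finite_dimensional_vector_space_pair_1
    "restrict_scalars \<iota> sV" BF "restrict_scalars \<iota> sA" by unfold_locales
  let ?S = "W \<inter> \<pi> -` T"
  have S: "F.subspace ?S" by (rule subspace_W_Int_vimage[OF assms])
  have "inj_on \<pi> (F.span ?S)"
    unfolding piF.inj_on_iff_eq_0[OF F.subspace_span]
    using S Gamma_Int_W kernel_pi by (auto simp: F.span_eq_iff[THEN iffD2])
  then have "A.F.dim (\<pi> ` ?S) = F.dim ?S"
    by (rule pair.dim_image_eq[OF piF.linear_axioms])
  moreover have "\<pi> ` ?S = U \<inter> T" unfolding U_eq by auto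
  ultimately show ?thesis by (simp add: weight_def)
qed

lemma defect_eq:
  "A.L.subspace T \<Longrightarrow> defect \<iota> sA U T = int (F.dim (W \<inter> \<pi> -` T)) - int (A.L.dim T)"
  by (simp add: defect_def weight_eq)

section \<open>Maximum defects as a function of the dimension\<close>

lemma finite_defects: "finite {defect \<iota> sA U T |T. A.L.subspace T \<and> A.L.dim T = r}"
\<comment> \<open>Weights lie between 0 and \<open>dim W\<close>; the resulting finiteness gives
  \<open>Max\<close> its meaning.\<close>
proof (rule finite_subset)
  show "{defect \<iota> sA U T |T. A.L.subspace T \<and> A.L.dim T = r} \<subseteq> {- int r..int (F.dim W) - int r}"
    using F.dim_subset[of "W \<inter> _" W] by (auto simp: defect_eq)
qed simp

lemma defect_le_max_defect:
  "A.L.subspace T \<Longrightarrow> defect \<iota> sA U T \<le> max_defect \<iota> sA U (A.L.dim T)"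
  unfolding max_defect_def using finite_defects by (intro Max_ge) auto

lemma max_defect_attained:
  assumes "r \<le> A.L.dim UNIV"
  obtains T where "A.L.subspace T" "A.L.dim T = r" "defect \<iota> sA U T = max_defect \<iota> sA U r"
proof -
  obtain T where "A.L.subspace T" "A.L.dim T = r"
    using A.L.choose_subspace_of_subspace[OF assms] .
  then have "max_defect \<iota> sA U r \<in> {defect \<iota> sA U T |T. A.L.subspace T \<and> A.L.dim T = r}"
    unfolding max_defect_def using finite_defects by (intro Max_in) auto
  then show thesis using that by auto
qed

lemma span_U: "A.L.span U = UNIV"
  unfolding U_eq using pi.span_image[of W] span_W surj_pi by simp

text \<open>A maximizing \<open>T\<close> that is not the whole space misses a vector of the
  spanning set \<open>U\<close>. Adjoining it raises the dimension by one and the weight by at least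
  one.\<close>

lemma max_defect_Suc:
  assumes "r < A.L.dim UNIV"
  shows "max_defect \<iota> sA U r \<le> max_defect \<iota> sA U (Suc r)"
proof -
  obtain T where T: "A.L.subspace T" "A.L.dim T = r" "defect \<iota> sA U T = max_defect \<iota> sA U r"
    using max_defect_attained assms by (metis less_imp_le)
  have "\<not> U \<subseteq> T"
  proof
    assume "U \<subseteq> T"
    then have "T = UNIV" using span_U A.L.span_minimal T by blast
    then show False using T assms by simp
  qed
  then obtain u where u: "u \<in> U" "u \<notin> T" by blast
  let ?T = "A.L.span (insert u T)"
  have dimT: "A.L.dim ?T = Suc r"
    using T u by (simp add: A.L.dim_insert A.L.span_eq_iff[THEN iffD2])
  have "A.F.span (U \<inter> T) \<subseteq> T"
    using T A.F.span_minimal[of "U \<inter> T" T] A.subspace_restrict_scalars by blast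
  then have "u \<notin> A.F.span (U \<inter> T)" using u by blast
  then have "weight \<iota> sA U T + 1 = A.F.dim (insert u (U \<inter> T))"
    by (simp add: weight_def A.F.dim_insert)
  also have "\<dots> \<le> weight \<iota> sA U ?T"
    unfolding weight_def using u A.L.span_superset[of "insert u T"] by (intro A.F.dim_subset) auto
  finally have "defect \<iota> sA U T \<le> defect \<iota> sA U ?T"
    using T dimT by (simp add: defect_def)
  also have "\<dots> \<le> max_defect \<iota> sA U (Suc r)"
    using defect_le_max_defect[OF A.L.subspace_span, of "insert u T"] dimT by simp
  finally show ?thesis using T by simp
qed

lemma max_defect_mono:
  assumes "r \<le> r'" "r' \<le> A.L.dim UNIV"
  shows "max_defect \<iota> sA U r \<le> max_defect \<iota> sA U r'"
  using assms
proof (induction r' rule: dec_induct)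
  case (step i)
  then show ?case using max_defect_Suc[of i] by simp
qed simp

lemma max_defect_0: "max_defect \<iota> sA U 0 = 0"
proof -
  obtain T where T: "A.L.subspace T" "A.L.dim T = 0" "defect \<iota> sA U T = max_defect \<iota> sA U 0"
    using max_defect_attained[of 0] by blast
  have "U \<inter> T \<subseteq> {0}" using T by auto
  then have "weight \<iota> sA U T = 0" unfolding weight_def by simp
  then have "defect \<iota> sA U T = 0" using T(2) unfolding defect_def by linarith
  then show ?thesis using T by simp
qed

lemma max_defect_dim: "max_defect \<iota> sA U (A.L.dim UNIV) = int (L.dim \<Gamma>)"
proof -
  obtain T where T: "A.L.subspace T" "A.L.dim T = A.L.dim UNIV"
      "defect \<iota> sA U T = max_defect \<iota> sA U (A.L.dim UNIV)"
    using max_defect_attained[of "A.L.dim UNIV"] by blast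
  have "T = UNIV" using A.L.subspace_dim_equal[of T UNIV] T by simp
  then have "defect \<iota> sA U T = int (L.dim UNIV) - int (A.L.dim UNIV)"
    using defect_eq[OF T(1)] dim_W by simp
  then show ?thesis using T dim_A by linarith
qed

lemma dim_image_rational:
  assumes "F.subspace S" "S \<subseteq> W"
  shows "A.L.dim (\<pi> ` L.span S) + L.dim (L.span S \<inter> \<Gamma>) = F.dim S"
  using dim_image_pi[OF L.subspace_span, of S] dim_rational[OF assms] by simp

text \<open>\<open>dim S\<close> exceeds the dimension of the image by
  \<open>dim (L.span S \<inter> \<Gamma>)\<close>. Only an inequality results, since vectors of
  \<open>W\<close> outside \<open>S\<close> may also map into that image.\<close>

lemma defect_image_rational:
  assumes S: "F.subspace S" "S \<subseteq> W"
  shows "int (L.dim (L.span S \<inter> \<Gamma>)) \<le> defect \<iota> sA U (\<pi> ` L.span S)"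
proof -
  have "S \<subseteq> W \<inter> \<pi> -` (\<pi> ` L.span S)" using S L.span_superset[of S] by auto
  then have "F.dim S \<le> F.dim (W \<inter> \<pi> -` (\<pi> ` L.span S))" by (rule F.dim_subset)
  then show ?thesis
    using dim_image_rational[OF S] defect_eq[OF pi.subspace_image[OF L.subspace_span[of S]]] by linarith
qed

text \<open>
  If \<open>T\<close> were larger than the span of \<open>T \<inter> U\<close>, then this smaller span would have a larger defect,
  contradicting the monotonicity of the maximum defect.
\<close>

lemma max_defect_subspace_rational:
  assumes T: "A.L.subspace T" "defect \<iota> sA U T = max_defect \<iota> sA U (A.L.dim T)"
  defines "S \<equiv> W \<inter> \<pi> -` T"
  shows "\<pi> ` L.span S = T" "A.L.span (T \<inter> U) = T"
    "int (L.dim (L.span S \<inter> \<Gamma>)) = defect \<iota> sA U T"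
proof -
  have S: "F.subspace S" "S \<subseteq> W" using subspace_W_Int_vimage[OF T(1)] S_def by auto
  have eq: "\<pi> ` L.span S = A.L.span (T \<inter> U)"
  proof -
    have "T \<inter> U = \<pi> ` S" unfolding S_def U_eq by auto
    then show ?thesis by (simp add: pi.span_image)
  qed
  have sub: "A.L.span (T \<inter> U) \<subseteq> T" using T A.L.span_minimal by blast
  have dimS: "int (F.dim S) = defect \<iota> sA U T + int (A.L.dim T)"
    using defect_eq[OF T(1)] S_def by simp
  have "A.L.dim (\<pi> ` L.span S) \<le> A.L.dim T" using eq sub A.L.dim_subset by simp
  then have "max_defect \<iota> sA U (A.L.dim (\<pi> ` L.span S)) \<le> max_defect \<iota> sA U (A.L.dim T)"
    by (rule max_defect_mono) (rule A.L.dim_subset[OF subset_UNIV])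
  then have "int (L.dim (L.span S \<inter> \<Gamma>)) \<le> defect \<iota> sA U T"
    using defect_image_rational[OF S] T(2)
      defect_le_max_defect[OF pi.subspace_image[OF L.subspace_span[of S]]] by linarith
  \<comment> \<open>Comparing the two expressions for \<open>dim S\<close> turns the bound on the
    intersection into a bound on \<open>dim T\<close>.\<close>
  then have "A.L.dim T \<le> A.L.dim (\<pi> ` L.span S)"
    using dim_image_rational[OF S] dimS by linarith
  then show "A.L.span (T \<inter> U) = T"
    using A.L.subspace_dim_equal[OF A.L.subspace_span T(1) sub] eq by simp
  with eq show "\<pi> ` L.span S = T" by simp
  then show "int (L.dim (L.span S \<inter> \<Gamma>)) = defect \<iota> sA U T"
    using dim_image_rational[OF S] dimS by simp
qed

end

section \<open>Delsarte duality\<close>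

text \<open>Both quotients instantiate the same locale, so facts on defects are proved once for
  \<open>U\<close> and its dual. The instance for \<open>\<Delta>\<close> includes
  \<open>\<Delta> \<inter> W = {0}\<close>, later obtained from the hyperplane assumption.\<close>

locale delsarte_pair = subgeometry_form \<iota> sV BL BF W \<sigma>' \<sigma> +
  P: linear_set \<iota> sV BL BF W sA AL AF \<Gamma> \<pi> + Q: linear_set \<iota> sV BL BF W sB CL CF \<Delta> \<rho>
  for \<iota> :: "'f::field \<Rightarrow> 'l::field" and sV :: "'l \<Rightarrow> 'v::ab_group_add \<Rightarrow> 'v" and BL BF W \<sigma>' \<sigma>
    and sA :: "'l \<Rightarrow> 'a::ab_group_add \<Rightarrow> 'a" and AL AF \<Gamma> \<pi>
    and sB :: "'l \<Rightarrow> 'b::ab_group_add \<Rightarrow> 'b" and CL CF \<Delta> \<rho> +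
  assumes Delta_eq: "\<Delta> = orth_compl \<sigma> \<Gamma>"
begin

text \<open>With the arguments of the form exchanged, \<open>\<Gamma>\<close> is the complement of
  \<open>\<Delta>\<close>. Every inequality passing from \<open>U\<close> to its dual therefore also
  passes back.\<close>

lemma flip_pair:
  "delsarte_pair \<iota> sV BL BF W (\<lambda>x y. \<sigma>' y x) (\<lambda>x y. \<sigma> y x) sB CL CF \<Delta> \<rho> sA AL AF \<Gamma> \<pi>"
proof -
  interpret flip: subgeometry_form \<iota> sV BL BF W "\<lambda>x y. \<sigma>' y x" "\<lambda>x y. \<sigma> y x"
    by (rule flip)
  show ?thesis
    by unfold_locales (simp add: Delta_eq orth_compl_orth_compl P.subspace_Gamma)
qed

lemma dim_Gamma: "L.dim \<Gamma> = Q.A.L.dim UNIV" and dim_Delta: "L.dim \<Delta> = P.A.L.dim UNIV"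
  using P.dim_A Q.dim_A dim_orth_compl[of \<Gamma>] Delta_eq by simp_all

lemma dual_subspace_eq: "dual_subspace sV \<sigma> W \<Gamma> \<pi> \<rho> T = \<rho> ` orth_compl \<sigma> (W \<inter> \<pi> -` T)"
proof -
  have "{w \<in> W. \<pi> w \<in> T} = W \<inter> \<pi> -` T" by auto
  moreover have "orth_compl \<sigma> (W \<inter> \<pi> -` T) \<noteq> {}"
    using L.subspace_0[OF subspace_orth_compl] by blast
  ultimately show ?thesis
    unfolding dual_subspace_def using Q.quotient_image_eq
    by (simp add: orth_compl_span flip: Delta_eq)
qed

text \<open>The span of \<open>?R\<close> meets \<open>\<Delta>\<close> in the complement of
  \<open>L.span S + \<Gamma>\<close>. The dimension formulas for sums and complements determine this
  intersection; rank-nullity for \<open>\<rho>\<close> then gives the dimension, and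
  \<open>defect_image_rational\<close> the defect bound.\<close>

lemma dual_rational:
  assumes S: "F.subspace S" "S \<subseteq> W"
  shows "Q.A.L.subspace (\<rho> ` orth_compl \<sigma> S)"
    and "Q.A.L.dim (\<rho> ` orth_compl \<sigma> S) + L.dim (L.span S \<inter> \<Gamma>) = L.dim \<Gamma>"
    and "int (L.dim \<Delta>) - int (P.A.L.dim (\<pi> ` L.span S)) \<le> defect \<iota> sB Q.U (\<rho> ` orth_compl \<sigma> S)"
proof -
  let ?M = "L.span S"
  let ?R = "W \<inter> orth_compl \<sigma> S"
  note R = orth_compl_rational[OF S]
  show "Q.A.L.subspace (\<rho> ` orth_compl \<sigma> S)"
    by (rule Q.pi.subspace_image[OF subspace_orth_compl])
  let ?Z = "{x + y |x y. x \<in> ?M \<and> y \<in> \<Gamma>}"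
  have "L.span ?R \<inter> \<Delta> = orth_compl \<sigma> ?Z"
    using orth_compl_sums[OF L.subspace_span P.subspace_Gamma, of S] R(3)
    by (simp add: orth_compl_span Delta_eq)
  then have "L.dim (L.span ?R \<inter> \<Delta>) + L.dim ?Z = L.dim UNIV"
    using dim_orth_compl[of ?Z] by simp
  moreover have "L.dim ?Z + L.dim (?M \<inter> \<Gamma>) = L.dim ?M + L.dim \<Gamma>"
    by (rule L.dim_sums_Int[OF L.subspace_span P.subspace_Gamma])
  moreover have "L.dim ?M = F.dim S" using dim_rational[OF S] by simp
  moreover note P.dim_image_rational[OF S]
  moreover have "L.dim \<Delta> + L.dim \<Gamma> = L.dim UNIV"
    using dim_orth_compl[of \<Gamma>] Delta_eq by simp
  ultimately have *: "L.dim (L.span ?R \<inter> \<Delta>) + P.A.L.dim (\<pi> ` ?M) = L.dim \<Delta>" by linarith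
  have RW: "?R \<subseteq> W" by simp
  have "Q.A.L.dim (\<rho> ` L.span ?R) + L.dim (L.span ?R \<inter> \<Delta>) = F.dim ?R"
    by (rule Q.dim_image_rational[OF R(1) RW])
  moreover have "F.dim ?R + F.dim S = L.dim UNIV" using R(2) dim_W by simp
  ultimately show "Q.A.L.dim (\<rho> ` orth_compl \<sigma> S) + L.dim (?M \<inter> \<Gamma>) = L.dim \<Gamma>"
    using * P.dim_image_rational[OF S] R(3) \<open>L.dim \<Delta> + L.dim \<Gamma> = L.dim UNIV\<close> by simp
  show "int (L.dim \<Delta>) - int (P.A.L.dim (\<pi> ` ?M)) \<le> defect \<iota> sB Q.U (\<rho> ` orth_compl \<sigma> S)"
    using Q.defect_image_rational[OF R(1) RW] * R(3) by simp
qed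

text \<open>Maximality makes \<open>T\<close> the image of the span of its preimage in
  \<open>W\<close>, and its defect the dimension in which that span meets \<open>\<Gamma>\<close>.
  This is what \<open>dual_rational\<close> needs.\<close>

lemma dual_max_defect_subspace:
  assumes T: "P.A.L.subspace T" "defect \<iota> sA P.U T = max_defect \<iota> sA P.U (P.A.L.dim T)"
  defines "X \<equiv> dual_subspace sV \<sigma> W \<Gamma> \<pi> \<rho> T"
  shows "Q.A.L.subspace X"
    and "int (Q.A.L.dim X) = int (L.dim \<Gamma>) - defect \<iota> sA P.U T"
    and "int (L.dim \<Delta>) - int (P.A.L.dim T) \<le> defect \<iota> sB Q.U X"
proof -
  let ?S = "W \<inter> \<pi> -` T"
  have S: "F.subspace ?S" "?S \<subseteq> W" using P.subspace_W_Int_vimage[OF T(1)] by auto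
  note rat = P.max_defect_subspace_rational[OF T]
  show "Q.A.L.subspace X" unfolding X_def dual_subspace_eq by (rule dual_rational(1)[OF S])
  show "int (Q.A.L.dim X) = int (L.dim \<Gamma>) - defect \<iota> sA P.U T"
    unfolding X_def dual_subspace_eq using dual_rational(2)[OF S] rat(3) by linarith
  show "int (L.dim \<Delta>) - int (P.A.L.dim T) \<le> defect \<iota> sB Q.U X"
    unfolding X_def dual_subspace_eq using dual_rational(3)[OF S] rat(1) by simp
qed

lemma max_defect_dual_ge:
  assumes "r \<le> P.A.L.dim UNIV"
  shows "int (P.A.L.dim UNIV) - int r
      \<le> max_defect \<iota> sB Q.U (nat (int (Q.A.L.dim UNIV) - max_defect \<iota> sA P.U r))"
proof -
  obtain T where T: "P.A.L.subspace T" "P.A.L.dim T = r" "defect \<iota> sA P.U T = max_defect \<iota> sA P.U r"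
    using P.max_defect_attained[OF assms] .
  let ?X = "dual_subspace sV \<sigma> W \<Gamma> \<pi> \<rho> T"
  have X: "Q.A.L.subspace ?X" "int (Q.A.L.dim ?X) = int (L.dim \<Gamma>) - defect \<iota> sA P.U T"
    "int (L.dim \<Delta>) - int (P.A.L.dim T) \<le> defect \<iota> sB Q.U ?X"
    using dual_max_defect_subspace[of T] T by simp_all
  \<comment> \<open>The difference is the dimension of \<open>?X\<close>, hence nonnegative, and
    \<open>nat\<close> loses nothing.\<close>
  have "nat (int (Q.A.L.dim UNIV) - max_defect \<iota> sA P.U r) = Q.A.L.dim ?X"
    using X(2) T dim_Gamma by linarith
  then show ?thesis
    using Q.defect_le_max_defect[OF X(1)] X(3) T(2) dim_Delta by simp
qed

end

text \<open>The preimage of \<open>T\<close> in \<open>W\<close> contains \<open>?S\<close>. The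
  assumed upper bound on the defect of \<open>T\<close> forces equality, and a double complement
  leads back to \<open>X\<close>.\<close>

lemma (in delsarte_pair) dual_dual_subspace:
  assumes X: "Q.A.L.subspace X" "defect \<iota> sB Q.U X = max_defect \<iota> sB Q.U (Q.A.L.dim X)"
  defines "T \<equiv> dual_subspace sV (\<lambda>x y. \<sigma> y x) W \<Delta> \<rho> \<pi> X"
  assumes T: "defect \<iota> sA P.U T \<le> int (L.dim \<Gamma>) - int (Q.A.L.dim X)"
  shows "dual_subspace sV \<sigma> W \<Gamma> \<pi> \<rho> T = X"
proof -
  interpret flip: delsarte_pair \<iota> sV BL BF W "\<lambda>x y. \<sigma>' y x" "\<lambda>x y. \<sigma> y x" sB CL CF \<Delta> \<rho> sA AL AF \<Gamma> \<pi>
    by (rule flip_pair)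
  let ?R = "W \<inter> \<rho> -` X"
  let ?O = "orth_compl (\<lambda>x y. \<sigma> y x) ?R"
  let ?S = "W \<inter> ?O"
  have R: "F.subspace ?R" "?R \<subseteq> W" using Q.subspace_W_Int_vimage[OF X(1)] by auto
  have T_eq: "T = \<pi> ` ?O" unfolding T_def by (rule flip.dual_subspace_eq)
  have subT: "P.A.L.subspace T" unfolding T_eq by (rule flip.dual_rational(1)[OF R])
  note S = flip.orth_compl_rational[OF R]
  have dimT: "int (P.A.L.dim T) = int (L.dim \<Delta>) - defect \<iota> sB Q.U X"
    unfolding T_def by (rule flip.dual_max_defect_subspace(2)[OF X])
  have "?S \<subseteq> W \<inter> \<pi> -` T" unfolding T_eq by auto
  \<comment> \<open>The preimage of \<open>T\<close> has dimension defect plus \<open>dim T\<close>,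
    which is at most \<open>n - dim ?R\<close>, the dimension of \<open>?S\<close>.\<close>
  moreover have "F.dim (W \<inter> \<pi> -` T) \<le> F.dim ?S"
    using P.defect_eq[OF subT] T dimT Q.defect_eq[OF X(1)] S(2) dim_W
      dim_orth_compl[of \<Gamma>] Delta_eq by simp
  ultimately have eq: "W \<inter> \<pi> -` T = ?S"
    using F.subspace_dim_equal[OF S(1) P.subspace_W_Int_vimage[OF subT]] by simp
  have "orth_compl \<sigma> ?S = orth_compl \<sigma> (L.span ?S)" by (simp add: orth_compl_span)
  also have "\<dots> = orth_compl \<sigma> ?O" using S(3) by simp
  also have "\<dots> = orth_compl \<sigma> (orth_compl (\<lambda>x y. \<sigma> y x) (L.span ?R))"
    by (simp add: flip.orth_compl_span)
  also have "\<dots> = L.span ?R" using flip.orth_compl_orth_compl[OF L.subspace_span] by simp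
  finally show ?thesis
    using eq Q.max_defect_subspace_rational(1)[OF X] by (simp add: dual_subspace_eq)
qed

text \<open>The left complement of \<open>w\<close> contains \<open>\<Gamma>\<close> and meets
  \<open>W\<close> in dimension \<open>n - 1\<close>; its image is the hyperplane sought. Under the
  hyperplane assumption no such \<open>w\<close> can therefore exist.\<close>

lemma (in subgeometry_form) heavy_hyperplane:
  assumes "linear_set \<iota> sV BL BF W sA AL AF \<Gamma> \<pi>"
    and w: "w \<in> W" "w \<in> orth_compl \<sigma> \<Gamma>" "w \<noteq> 0"
  obtains H where "module.subspace sA H" "vector_space.dim sA H + 1 = vector_space.dim sA UNIV"
    "F.dim W \<le> weight \<iota> sA (quotient_image \<pi> \<Gamma> W) H + 1"
proof -
  interpret P: linear_set \<iota> sV BL BF W sA AL AF \<Gamma> \<pi> by fact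
  interpret flip: subgeometry_form \<iota> sV BL BF W "\<lambda>x y. \<sigma>' y x" "\<lambda>x y. \<sigma> y x"
    by (rule flip)
  let ?K = "orth_compl (\<lambda>x y. \<sigma> y x) {w}"
  let ?S = "F.span {w}"
  let ?H = "\<pi> ` ?K"
  have H: "P.A.L.subspace ?H" by (rule P.pi.subspace_image[OF flip.subspace_orth_compl])
  have "?K \<inter> \<Gamma> = \<Gamma>" using w by (auto simp: orth_compl_def)
  then have "P.A.L.dim ?H + L.dim \<Gamma> = L.dim ?K"
    using P.dim_image_pi[OF flip.subspace_orth_compl, of "{w}"] by simp
  moreover have "L.dim ?K + 1 = L.dim UNIV"
    using flip.dim_orth_compl[of "{w}"] w L.dim_singleton[of w] by presburger
  ultimately have dimH: "P.A.L.dim ?H + 1 = P.A.L.dim UNIV" using P.dim_A by linarith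
  have S: "F.subspace ?S" "?S \<subseteq> W" using w F.span_minimal[OF _ subspace_W] by auto
  have "F.dim ?S = 1" using w by simp
  then have "F.dim W = F.dim (W \<inter> orth_compl (\<lambda>x y. \<sigma> y x) ?S) + 1"
    using flip.orth_compl_rational(2)[OF S] by simp
  also have "F.dim (W \<inter> orth_compl (\<lambda>x y. \<sigma> y x) ?S) \<le> F.dim (W \<inter> \<pi> -` ?H)"
    using F.span_base[of w "{w}"] by (intro F.dim_subset) (auto simp: orth_compl_def)
  finally have "F.dim W \<le> weight \<iota> sA P.U ?H + 1" using P.weight_eq[OF H] by simp
  then show thesis using that H dimH by blast
qed

section \<open>Restriction of scalars for the given spaces\<close>

lemma vector_space_restrict_scalars:
  assumes "field_embedding \<iota>" "vector_space s"
  shows "vector_space (restrict_scalars \<iota> s)"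
proof -
  interpret vector_space s by fact
  show ?thesis
    using assms(1) unfolding field_embedding_def restrict_scalars_def
    by unfold_locales (simp_all add: scale_right_distrib scale_left_distrib)
qed

lemma extension_space_exists:
  assumes "field_embedding \<iota>" "vector_space (s :: _ \<Rightarrow> 'v::ab_group_add \<Rightarrow> 'v)" "finite (UNIV :: 'v set)"
  obtains BL BF where "extension_space \<iota> s BL BF"
  using vector_space.finite_dimensionalI[OF assms(2,3)]
    vector_space.finite_dimensionalI[OF vector_space_restrict_scalars[OF assms(1,2)] assms(3)]
  unfolding extension_space_def by metis

section \<open>Step functions in Galois connection\<close>

text \<open>Stated for an arbitrary integer function, so that the exchange of the two defect
  sequences becomes pure arithmetic.\<close>

definition jump_values :: "(nat \<Rightarrow> int) \<Rightarrow> nat \<Rightarrow> int set" where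
  "jump_values f k = {e. 0 < e \<and> (\<exists>r\<le>k. f r = e)}"

definition jump_pos :: "(nat \<Rightarrow> int) \<Rightarrow> nat \<Rightarrow> int \<Rightarrow> nat" where
  "jump_pos f k e = (LEAST r. r \<le> k \<and> f r = e)"

lemma finite_jump_values: "finite (jump_values f k)"
proof (rule finite_subset)
  show "jump_values f k \<subseteq> f ` {..k}" unfolding jump_values_def by auto
qed simp

lemma jump_pos:
  assumes "e \<in> jump_values f k"
  shows "jump_pos f k e \<le> k" "f (jump_pos f k e) = e"
proof -
  have "\<exists>r. r \<le> k \<and> f r = e" using assms unfolding jump_values_def by auto
  from LeastI_ex[OF this] show "jump_pos f k e \<le> k" "f (jump_pos f k e) = e"
    unfolding jump_pos_def by auto
qed

lemma jump_pos_le: "r \<le> k \<Longrightarrow> f r = e \<Longrightarrow> jump_pos f k e \<le> r"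
  unfolding jump_pos_def by (rule Least_le) simp

text \<open>\<open>f\<close> and \<open>g\<close> stand for the maximum defects of \<open>U\<close>
  and its dual, \<open>k\<close> and \<open>l = n - k\<close> for the dimensions of the two
  quotients. By \<open>f_pred_k\<close>, the top value of \<open>f\<close> is reached only at
  \<open>k\<close>.\<close>

locale galois_steps =
  fixes f g :: "nat \<Rightarrow> int" and k l :: nat
  assumes pos: "0 < k" "0 < l"
    and mono_f: "\<And>r r'. r \<le> r' \<Longrightarrow> r' \<le> k \<Longrightarrow> f r \<le> f r'"
    and mono_g: "\<And>x x'. x \<le> x' \<Longrightarrow> x' \<le> l \<Longrightarrow> g x \<le> g x'"
    and f_0: "f 0 = 0" and f_k: "f k = int l" and g_0: "g 0 = 0" and g_l: "g l = int k"
    and galois_f: "\<And>r. r \<le> k \<Longrightarrow> int k - int r \<le> g (nat (int l - f r))"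
    and galois_g: "\<And>x. x \<le> l \<Longrightarrow> int l - int x \<le> f (nat (int k - g x))"
    and f_pred_k: "f (k - 1) < int l"
begin

abbreviation "p \<equiv> jump_pos f k"

lemma f_bounds: "r \<le> k \<Longrightarrow> 0 \<le> f r \<and> f r \<le> int l"
  using mono_f[of 0 r] mono_f[of r k] f_0 f_k by simp

lemma g_bounds: "x \<le> l \<Longrightarrow> 0 \<le> g x \<and> g x \<le> int k"
  using mono_g[of 0 x] mono_g[of x l] g_0 g_l by simp

lemma jump_values_bounds: "e \<in> jump_values f k \<Longrightarrow> 0 < e \<and> e \<le> int l"
  using f_bounds unfolding jump_values_def by auto

lemma l_in_jump_values: "int l \<in> jump_values f k"
  unfolding jump_values_def using f_k pos by auto

lemma jump_pos_mono:
  assumes "e \<in> jump_values f k" "e' \<in> jump_values f k" "e < e'"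
  shows "p e < p e'"
  using mono_f[of "p e'" "p e"] jump_pos[OF assms(1)] jump_pos[OF assms(2)] assms(3)
  by force

lemma jump_pos_l: "p (int l) = k"
proof (rule antisym)
  show "p (int l) \<le> k" by (rule jump_pos(1)[OF l_in_jump_values])
  show "k \<le> p (int l)"
  proof (rule ccontr)
    assume "\<not> k \<le> p (int l)"
    then have "f (p (int l)) \<le> f (k - 1)" by (intro mono_f) auto
    then show False using jump_pos(2)[OF l_in_jump_values] f_pred_k by simp
  qed
qed

text \<open>If \<open>g\<close> exceeded \<open>k - p e\<close> at \<open>l - e\<close>, then
  \<open>?r\<close> would lie before \<open>p e\<close>, and \<open>galois_g\<close> with
  monotonicity would give \<open>f ?r = e\<close>, against the minimality of
  \<open>p e\<close>.\<close>

lemma g_at_jump: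
  assumes e: "e \<in> jump_values f k"
  shows "g (nat (int l - e)) = int k - int (p e)"
proof (rule antisym)
  note eb = jump_values_bounds[OF e] and pe = jump_pos[OF e]
  show "int k - int (p e) \<le> g (nat (int l - e))" using galois_f[of "p e"] pe by simp
  let ?x = "nat (int l - e)"
  let ?r = "nat (int k - g ?x)"
  have x: "?x \<le> l" "int ?x = int l - e" using eb by auto
  show "g ?x \<le> int k - int (p e)"
  proof (rule ccontr)
    assume "\<not> g ?x \<le> int k - int (p e)"
    then have r: "?r < p e" using g_bounds[OF x(1)] by linarith
    have "e \<le> f ?r" using galois_g[OF x(1)] x(2) by linarith
    moreover have "f ?r \<le> e" using mono_f[of ?r "p e"] r pe by simp
    ultimately show False using jump_pos_le[of ?r k f e] r pe by simp
  qed
qed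

lemma jump_values_g:
  "jump_values g l = insert (int k) ((\<lambda>e. int k - int (p e)) ` (jump_values f k - {int l}))"
proof (intro equalityI subsetI)
  fix y assume "y \<in> insert (int k) ((\<lambda>e. int k - int (p e)) ` (jump_values f k - {int l}))"
  then consider "y = int k" | e where "e \<in> jump_values f k" "e \<noteq> int l" "y = int k - int (p e)"
    by auto
  then show "y \<in> jump_values g l"
  proof cases
    case 1
    then show ?thesis using g_l pos unfolding jump_values_def by auto
  next
    case 2
    note eb = jump_values_bounds[OF 2(1)]
    have "p e < k" using jump_pos_mono[OF 2(1) l_in_jump_values] 2(2) eb jump_pos_l by simp
    then show ?thesis
      using g_at_jump[OF 2(1)] 2(3) eb unfolding jump_values_def
      by (auto intro!: exI[of _ "nat (int l - e)"])
  qed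
next
  fix y assume "y \<in> jump_values g l"
  then obtain x where x: "x \<le> l" "g x = y" "0 < y" unfolding jump_values_def by auto
  \<comment> \<open>To have \<open>y = k - p e\<close>, the position \<open>p e\<close> must be
    \<open>k - y\<close>; the value of \<open>f\<close> there is the only candidate for
    \<open>e\<close>.\<close>
  let ?r = "nat (int k - y)"
  have yk: "y \<le> int k" using g_bounds[OF x(1)] x by simp
  have fr: "int l - int x \<le> f ?r" using galois_g[OF x(1)] x by simp
  show "y \<in> insert (int k) ((\<lambda>e. int k - int (p e)) ` (jump_values f k - {int l}))"
  proof (cases "y = int k")
    case False
    have "x \<noteq> l" using False x g_l by auto
    then have fpos: "0 < f ?r" using fr x by simp
    have "f ?r \<le> f (k - 1)" using x(3) by (intro mono_f) auto
    then have "f ?r \<noteq> int l" using f_pred_k by simp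
    moreover have e: "f ?r \<in> jump_values f k"
      using fpos x(3) unfolding jump_values_def by (auto intro!: exI[of _ ?r])
    moreover have "p (f ?r) = ?r"
    proof (rule antisym)
      show "p (f ?r) \<le> ?r" using x(3) by (intro jump_pos_le) auto
      \<comment> \<open>The left side equals \<open>k - p (f ?r)\<close> and the right side
        \<open>k - ?r\<close>, so \<open>f ?r\<close> is not attained before
        \<open>?r\<close>.\<close>
      have "g (nat (int l - f ?r)) \<le> g x" using fr x(1) by (intro mono_g) auto
      then show "?r \<le> p (f ?r)" using g_at_jump[OF e] x(2) by linarith
    qed
    ultimately show ?thesis using yk by (auto intro!: image_eqI[of _ _ "f ?r"])
  qed simp
qed

text \<open>Minimality comes from \<open>galois_g\<close>: any \<open>x\<close> with the same value
  satisfies \<open>l - x <= f (p e) = e\<close>.\<close>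

lemma jump_pos_g:
  assumes e: "e \<in> jump_values f k"
  shows "jump_pos g l (int k - int (p e)) = nat (int l - e)"
  unfolding jump_pos_def[of g]
proof (rule Least_equality)
  note eb = jump_values_bounds[OF e] and pe = jump_pos[OF e]
  show "nat (int l - e) \<le> l \<and> g (nat (int l - e)) = int k - int (p e)"
    using g_at_jump[OF e] eb by auto
  fix x assume x: "x \<le> l \<and> g x = int k - int (p e)"
  then have "int l - int x \<le> f (p e)" using galois_g[of x] pe by simp
  then show "nat (int l - e) \<le> x" using pe by simp
qed

lemma jump_pos_g_k: "jump_pos g l (int k) = l"
  unfolding jump_pos_def
proof (rule Least_equality)
  fix x assume "x \<le> l \<and> g x = int k"
  then show "l \<le> x" using galois_g[of x] f_0 by simp
qed (simp add: g_l)

lemma sorted_jump_values: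
  "sorted_list_of_set (jump_values f k) = sorted_list_of_set (jump_values f k - {int l}) @ [int l]"
proof (rule sorted_distinct_set_unique)
  show "sorted (sorted_list_of_set (jump_values f k - {int l}) @ [int l])"
    using jump_values_bounds finite_jump_values[of f k] by (auto simp: sorted_append)
qed (use l_in_jump_values finite_jump_values[of f k] in auto)

text \<open>Sending \<open>e\<close> to \<open>k - p e\<close> reverses the strict order, hence the
  reversed list. \<open>k\<close> comes last because every \<open>p e\<close> is positive.\<close>

lemma sorted_jump_values_g:
  "sorted_list_of_set (jump_values g l) =
   map (\<lambda>e. int k - int (p e)) (rev (sorted_list_of_set (jump_values f k - {int l}))) @ [int k]"
proof -
  let ?J = "jump_values f k - {int l}"
  let ?xs = "sorted_list_of_set ?J"
  have fin: "finite ?J" using finite_jump_values by auto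
  have set_xs: "set ?xs = ?J" using fin by simp
  have "sorted_wrt (<) ?xs" by simp
  then have "sorted_wrt (\<lambda>e e'. int k - int (p e') < int k - int (p e)) ?xs"
    by (rule sorted_wrt_mono_rel[rotated]) (use set_xs jump_pos_mono in auto)
  moreover have "0 < p e" if "e \<in> ?J" for e
  proof (rule ccontr)
    assume "\<not> 0 < p e"
    then show False using that jump_pos(2)[of e f k] f_0 jump_values_bounds[of e] by auto
  qed
  ultimately have "sorted_wrt (<) (map (\<lambda>e. int k - int (p e)) (rev ?xs) @ [int k])"
    using set_xs by (auto simp: sorted_wrt_append sorted_wrt_map sorted_wrt_rev)
  moreover have "set (map (\<lambda>e. int k - int (p e)) (rev ?xs) @ [int k]) = jump_values g l"
    using set_xs jump_values_g by simp
  ultimately show ?thesis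
    by (metis finite_jump_values set_sorted_list_of_set strict_sorted_equal
        sorted_list_of_set.strict_sorted_key_list_of_set)
qed

end

text \<open>The defect sequences are indexed from 1, while list positions start at 0.\<close>

lemma map_nth_shifted: "map (\<lambda>i. h (xs ! (i - 1))) [1..<length xs + 1] = map h xs"
  by (intro nth_equalityI) (simp_all add: nth_append del: upt_Suc)

section \<open>Instantiation of the duality and assembly of the three claims\<close>

theorem theorem1p28:
  fixes q m n k s :: nat
    and \<iota> :: "'f::{field,finite} \<Rightarrow> 'l::{field,finite}"
    and sV :: "'l \<Rightarrow> 'v::ab_group_add \<Rightarrow> 'v"
    and sA :: "'l \<Rightarrow> 'a::ab_group_add \<Rightarrow> 'a"
    and sB :: "'l \<Rightarrow> 'b::ab_group_add \<Rightarrow> 'b"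
    and W \<Gamma> :: "'v set"
    and \<sigma>' :: "'v \<Rightarrow> 'v \<Rightarrow> 'f" and \<sigma> :: "'v \<Rightarrow> 'v \<Rightarrow> 'l"
    and \<pi> :: "'v \<Rightarrow> 'a" and \<rho> :: "'v \<Rightarrow> 'b"
    and U :: "'a set" and Ud :: "'b set"
    and t :: "nat \<Rightarrow> nat" and \<epsilon> :: "nat \<Rightarrow> int"
  assumes "primepow q" and "0 < m" and "1 \<le> k" and "k < n"
    and "CARD('f) = q" and "CARD('l) = q ^ m" and "field_embedding \<iota>"
    and "vector_space sV" and "vector_space.dim sV UNIV = n"
    and "module.subspace (restrict_scalars \<iota> sV) W"
    and "vector_space.dim (restrict_scalars \<iota> sV) W = n"
    and "module.span sV W = UNIV"
    and "bilinear_form_on (restrict_scalars \<iota> sV) W \<sigma>'"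
    and "reflexive_form_on W \<sigma>'" and "nondegenerate_form_on W \<sigma>'"
    and "bilinear_form_on sV UNIV \<sigma>"
    and "\<forall>x\<in>W. \<forall>y\<in>W. \<sigma> x y = \<iota> (\<sigma>' x y)"
    and "module.subspace sV \<Gamma>" and "vector_space.dim sV \<Gamma> = n - k" and "\<Gamma> \<inter> W = {0}"
    and "vector_space sA" and "quotient_map sV sA \<Gamma> \<pi>"
    and "vector_space sB" and "quotient_map sV sB (orth_compl \<sigma> \<Gamma>) \<rho>"
    and "U = quotient_image \<pi> \<Gamma> W" and "Ud = quotient_image \<rho> (orth_compl \<sigma> \<Gamma>) W"
    and "\<forall>H. module.subspace sA H \<and> vector_space.dim sA H = k - 1 \<longrightarrow> weight \<iota> sA U H < n - 1"
    and "s = defect_seq_length \<iota> sA U"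
    and "t = defect_seq_pos \<iota> sA U" and "\<epsilon> = defect_seq_val \<iota> sA U"
  shows
    \<comment> \<open>(i)\<close>
    "(\<forall>r\<in>{1..k - 1}. 0 < max_defect \<iota> sA U r \<longrightarrow>
        max_defect \<iota> sB Ud (nat (int n - int k - max_defect \<iota> sA U r)) \<ge> int k - int r
        \<and> int k - int r > 0)
     \<and>
     \<comment> \<open>(ii)\<close>
     (t s = k \<and> \<epsilon> s = int n - int k \<and>
      (\<forall>i\<in>{1..s - 1}.
        max_defect \<iota> sB Ud (nat (int n - int k - \<epsilon> i)) = int k - int (t i)
        \<and>
        (\<forall>T. module.subspace sA T \<and> vector_space.dim sA T = t i \<and> defect \<iota> sA U T = \<epsilon> i \<longrightarrow>
           module.span sA (T \<inter> U) = T
           \<and> int (vector_space.dim sB (dual_subspace sV \<sigma> W \<Gamma> \<pi> \<rho> T)) = int n - int k - \<epsilon> i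
           \<and> defect \<iota> sB Ud (dual_subspace sV \<sigma> W \<Gamma> \<pi> \<rho> T) = int k - int (t i))
        \<and>
        (\<forall>X. module.subspace sB X \<and> int (vector_space.dim sB X) = int n - int k - \<epsilon> i
             \<and> defect \<iota> sB Ud X = int k - int (t i) \<longrightarrow>
           (\<exists>T. module.subspace sA T \<and> vector_space.dim sA T = t i \<and> defect \<iota> sA U T = \<epsilon> i
                \<and> X = dual_subspace sV \<sigma> W \<Gamma> \<pi> \<rho> T))))
     \<and>
     \<comment> \<open>(iii)\<close>
     (defect_seq \<iota> sB Ud =
        map (\<lambda>i. (nat (int n - int k - \<epsilon> i), int k - int (t i))) (rev [1..<s])
        @ [(n - k, int k)]
      \<and> defect_seq_length \<iota> sB Ud = s)"
proof -
  note vsV = assms(8) and vsA = assms(21) and vsB = assms(23) and emb = assms(7)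
  define l where "l = n - k"
  have l: "0 < l" "int l = int n - int k" "n - k = l" using assms(4) l_def by auto
  have finV: "finite (UNIV :: 'v set)"
  proof -
    obtain B where "B \<subseteq> UNIV" "\<not> module.dependent sV B" and B: "UNIV \<subseteq> module.span sV B"
      and "card B = n"
      using vector_space.basis_exists[OF vsV, of UNIV] assms(9) by metis
    \<comment> \<open>An infinite basis would have \<open>card\<close> 0, which \<open>n > 0\<close>
      excludes.\<close>
    then have "finite B" using assms(4) by (metis card.infinite not_less0)
    then show ?thesis
      using vector_space.finite_UNIV_if_finite_spanning[OF vsV] B finite_class.finite_UNIV by blast
  qed
  have finA: "finite (UNIV :: 'a set)" and finB: "finite (UNIV :: 'b set)"
    using finV assms(22,24) unfolding quotient_map_def by (metis finite_imageI)+
  obtain BL BF where "extension_space \<iota> sV BL BF" using extension_space_exists[OF emb vsV finV] .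
  then interpret V: extension_space \<iota> sV BL BF .
  obtain AL AF where "extension_space \<iota> sA AL AF" using extension_space_exists[OF emb vsA finA] .
  then interpret A: extension_space \<iota> sA AL AF .
  obtain CL CF where "extension_space \<iota> sB CL CF" using extension_space_exists[OF emb vsB finB] .
  then interpret B: extension_space \<iota> sB CL CF .
  interpret form: subgeometry_form \<iota> sV BL BF W \<sigma>' \<sigma>
    using assms(7,9-13,15-17) by unfold_locales auto
  interpret P: linear_set \<iota> sV BL BF W sA AL AF \<Gamma> \<pi>
    using assms(20,22) by unfold_locales auto
  define \<Delta> where "\<Delta> = orth_compl \<sigma> \<Gamma>"
  have dimA: "vector_space.dim sA UNIV = k" using P.dim_A assms(4,9,19) by linarith
  have U: "U = P.U" by (rule assms(25))
  have light: "weight \<iota> sA U H < n - 1" if "A.L.subspace H" "A.L.dim H = k - 1" for H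
    using assms(27) that by blast
  \<comment> \<open>A nonzero common vector would produce a hyperplane of weight at least
    \<open>n - 1\<close>.\<close>
  have Delta_Int: "\<Delta> \<inter> W = {0}"
  proof -
    have "w = 0" if w: "w \<in> W" "w \<in> orth_compl \<sigma> \<Gamma>" for w
    proof (rule ccontr)
      assume "w \<noteq> 0"
      then obtain H where H: "A.L.subspace H" "A.L.dim H + 1 = A.L.dim UNIV"
        "V.F.dim W \<le> weight \<iota> sA P.U H + 1"
        using form.heavy_hyperplane[OF P.linear_set_axioms w] by blast
      have "A.L.dim H = k - 1" using H(2) dimA by linarith
      then show False using light[OF H(1)] H(3) assms(11) U by simp
    qed
    then show ?thesis
      using V.L.subspace_0[OF form.subspace_orth_compl] V.F.subspace_0[OF assms(10)]
      unfolding \<Delta>_def by blast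
  qed
  interpret Q: linear_set \<iota> sV BL BF W sB CL CF \<Delta> \<rho>
    using assms(24) Delta_Int by unfold_locales (simp_all add: \<Delta>_def)
  interpret D: delsarte_pair \<iota> sV BL BF W \<sigma>' \<sigma> sA AL AF \<Gamma> \<pi> sB CL CF \<Delta> \<rho>
    by unfold_locales (rule \<Delta>_def)
  interpret flip: delsarte_pair \<iota> sV BL BF W "\<lambda>x y. \<sigma>' y x" "\<lambda>x y. \<sigma> y x" sB CL CF \<Delta> \<rho> sA AL AF \<Gamma> \<pi>
    by (rule D.flip_pair)
  have Ud: "Ud = Q.U" using assms(26) by (simp add: \<Delta>_def)
  have dimG: "V.L.dim \<Gamma> = l" using assms(19) l_def by simp
  have dimB: "vector_space.dim sB UNIV = l" using D.dim_Gamma dimG by simp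
  have dimD: "V.L.dim \<Delta> = k" using D.dim_Delta dimA by simp
  let ?f = "max_defect \<iota> sA U" and ?g = "max_defect \<iota> sB Ud"
  interpret G: galois_steps ?f ?g k l
  proof
    show "0 < k" using assms(3) by simp
    show "0 < l" by (rule l)
    show "?f r \<le> ?f r'" if "r \<le> r'" "r' \<le> k" for r r'
      using P.max_defect_mono that unfolding dimA U by blast
    show "?g x \<le> ?g x'" if "x \<le> x'" "x' \<le> l" for x x'
      using Q.max_defect_mono that unfolding dimB Ud by blast
    show "?f 0 = 0" unfolding U by (rule P.max_defect_0)
    show "?g 0 = 0" unfolding Ud by (rule Q.max_defect_0)
    show "?f k = int l" using P.max_defect_dim unfolding dimA dimG U .
    show "?g l = int k" using Q.max_defect_dim unfolding dimB dimD Ud .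
    show "int k - int r \<le> ?g (nat (int l - ?f r))" if "r \<le> k" for r
      using D.max_defect_dual_ge[of r] that unfolding dimA dimB U Ud by blast
    show "int l - int x \<le> ?f (nat (int k - ?g x))" if "x \<le> l" for x
      using flip.max_defect_dual_ge[of x] that unfolding dimA dimB U Ud by blast
    \<comment> \<open>A weight below \<open>n - 1\<close> in dimension \<open>k - 1\<close> means a
      defect below \<open>n - k\<close>.\<close>
    show "?f (k - 1) < int l"
    proof -
      obtain T where T: "A.L.subspace T" "A.L.dim T = k - 1" "defect \<iota> sA P.U T = max_defect \<iota> sA P.U (k - 1)"
        using P.max_defect_attained[of "k - 1"] unfolding dimA by auto
      have "?f (k - 1) = int (weight \<iota> sA U T) - int (k - 1)" using T U by (simp add: defect_def)
      then show ?thesis using light[OF T(1,2)] l assms(3) by linarith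
    qed
  qed
  let ?J = "jump_values ?f k - {int l}"
  \<comment> \<open>\<open>ys\<close> lists the values before the top one \<open>l\<close>, in
    increasing order; it has length \<open>s - 1\<close>.\<close>
  define ys where "ys = sorted_list_of_set ?J"
  have J: "nonzero_max_defects \<iota> sA U = jump_values ?f k"
    "nonzero_max_defects \<iota> sB Ud = jump_values ?g l"
    unfolding nonzero_max_defects_def jump_values_def dimA dimB by simp_all
  have xs: "sorted_list_of_set (jump_values ?f k) = ys @ [int l]" unfolding ys_def by (rule G.sorted_jump_values)
  have set_ys: "set ys = ?J" using finite_jump_values[of ?f k] by (simp add: ys_def)
  have s: "s = length ys + 1"
    unfolding assms(28) defect_seq_length_def J using xs
    by (metis length_append_singleton length_sorted_list_of_set Suc_eq_plus1)
  have \<epsilon>: "\<epsilon> i = (ys @ [int l]) ! (i - 1)" for i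
    unfolding assms(30) defect_seq_val_def J xs by simp
  have t: "t i = jump_pos ?f k (\<epsilon> i)" for i
    unfolding assms(29) assms(30) defect_seq_pos_def jump_pos_def dimA by simp
  have \<epsilon>_ys: "\<epsilon> i = ys ! (i - 1)" "\<epsilon> i \<in> ?J" if "i \<in> {1..s - 1}" for i
  proof -
    have "i - 1 < length ys" using that s by auto
    then show eq: "\<epsilon> i = ys ! (i - 1)" using \<epsilon>[of i] by (simp only: nth_append if_True)
    show "\<epsilon> i \<in> ?J" unfolding eq using \<open>i - 1 < length ys\<close> nth_mem set_ys by blast
  qed
  have part1: "\<forall>r\<in>{1..k - 1}. 0 < ?f r \<longrightarrow>
      ?g (nat (int n - int k - ?f r)) \<ge> int k - int r \<and> int k - int r > 0"
    using G.galois_f assms(3) unfolding l(2) by auto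
  have last: "t s = k \<and> \<epsilon> s = int n - int k"
  proof -
    have "\<epsilon> s = int l" using \<epsilon>[of s] s by simp
    then show ?thesis using t[of s] G.jump_pos_l l(2) by simp
  qed
  have part2: "?g (nat (int n - int k - \<epsilon> i)) = int k - int (t i)"
    "\<forall>T. A.L.subspace T \<and> A.L.dim T = t i \<and> defect \<iota> sA U T = \<epsilon> i \<longrightarrow>
       A.L.span (T \<inter> U) = T
       \<and> int (B.L.dim (dual_subspace sV \<sigma> W \<Gamma> \<pi> \<rho> T)) = int n - int k - \<epsilon> i
       \<and> defect \<iota> sB Ud (dual_subspace sV \<sigma> W \<Gamma> \<pi> \<rho> T) = int k - int (t i)"
    "\<forall>X. B.L.subspace X \<and> int (B.L.dim X) = int n - int k - \<epsilon> i
         \<and> defect \<iota> sB Ud X = int k - int (t i) \<longrightarrow>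
       (\<exists>T. A.L.subspace T \<and> A.L.dim T = t i \<and> defect \<iota> sA U T = \<epsilon> i
            \<and> X = dual_subspace sV \<sigma> W \<Gamma> \<pi> \<rho> T)"
    if i: "i \<in> {1..s - 1}" for i
  proof -
    have e: "\<epsilon> i \<in> jump_values ?f k" using \<epsilon>_ys[OF i] by simp
    note pe = jump_pos[OF e, folded t]
    show g: "?g (nat (int n - int k - \<epsilon> i)) = int k - int (t i)"
      using G.g_at_jump[OF e, folded t] unfolding l(2) .
    show "\<forall>T. A.L.subspace T \<and> A.L.dim T = t i \<and> defect \<iota> sA U T = \<epsilon> i \<longrightarrow>
       A.L.span (T \<inter> U) = T
       \<and> int (B.L.dim (dual_subspace sV \<sigma> W \<Gamma> \<pi> \<rho> T)) = int n - int k - \<epsilon> i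
       \<and> defect \<iota> sB Ud (dual_subspace sV \<sigma> W \<Gamma> \<pi> \<rho> T) = int k - int (t i)"
    proof (intro allI impI)
      fix T assume T: "A.L.subspace T \<and> A.L.dim T = t i \<and> defect \<iota> sA U T = \<epsilon> i"
      then have T': "A.L.subspace T" "defect \<iota> sA P.U T = max_defect \<iota> sA P.U (A.L.dim T)"
        using pe U by simp_all
      let ?X = "dual_subspace sV \<sigma> W \<Gamma> \<pi> \<rho> T"
      note X = D.dual_max_defect_subspace[OF T']
      have dimX: "int (B.L.dim ?X) = int n - int k - \<epsilon> i" using X(2) T U dimG l(2) by simp
      then have "B.L.dim ?X = nat (int n - int k - \<epsilon> i)" by linarith
      \<comment> \<open>The maximum in this dimension bounds the defect from above, and duality
        bounds it from below by the same number.\<close>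
      then have "defect \<iota> sB Ud ?X \<le> int k - int (t i)"
        using Q.defect_le_max_defect[OF X(1)] g Ud by simp
      moreover have "int k - int (t i) \<le> defect \<iota> sB Ud ?X"
        using X(3) T dimD Ud by simp
      ultimately show "A.L.span (T \<inter> U) = T \<and> int (B.L.dim ?X) = int n - int k - \<epsilon> i
          \<and> defect \<iota> sB Ud ?X = int k - int (t i)"
        using dimX P.max_defect_subspace_rational(2)[OF T'] U by simp
    qed
    show "\<forall>X. B.L.subspace X \<and> int (B.L.dim X) = int n - int k - \<epsilon> i
         \<and> defect \<iota> sB Ud X = int k - int (t i) \<longrightarrow>
       (\<exists>T. A.L.subspace T \<and> A.L.dim T = t i \<and> defect \<iota> sA U T = \<epsilon> i
            \<and> X = dual_subspace sV \<sigma> W \<Gamma> \<pi> \<rho> T)"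
    proof (intro allI impI)
      fix X assume X: "B.L.subspace X \<and> int (B.L.dim X) = int n - int k - \<epsilon> i
         \<and> defect \<iota> sB Ud X = int k - int (t i)"
      then have "B.L.dim X = nat (int n - int k - \<epsilon> i)" by linarith
      then have X': "B.L.subspace X" "defect \<iota> sB Q.U X = max_defect \<iota> sB Q.U (B.L.dim X)"
        using X g Ud by simp_all
      \<comment> \<open>The witness is the dual of \<open>X\<close> for the flipped form. Since
        \<open>dim X = n - k - \<epsilon> i\<close>, the bound \<open>le\<close> below is the
        hypothesis that \<open>dual_dual_subspace\<close> needs.\<close>
      let ?T = "dual_subspace sV (\<lambda>x y. \<sigma> y x) W \<Delta> \<rho> \<pi> X"
      note T = flip.dual_max_defect_subspace[OF X']
      have dimT: "A.L.dim ?T = t i" using T(2) X dimD Ud by simp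
      have le: "defect \<iota> sA U ?T \<le> \<epsilon> i"
        using P.defect_le_max_defect[OF T(1)] dimT pe U by simp
      moreover have "\<epsilon> i \<le> defect \<iota> sA U ?T" using T(3) X dimG l(2) U by simp
      moreover have "dual_subspace sV \<sigma> W \<Gamma> \<pi> \<rho> ?T = X"
        using D.dual_dual_subspace[OF X'] le X dimG l(2) U by simp
      ultimately show "\<exists>T. A.L.subspace T \<and> A.L.dim T = t i \<and> defect \<iota> sA U T = \<epsilon> i
            \<and> X = dual_subspace sV \<sigma> W \<Gamma> \<pi> \<rho> T"
        using T(1) dimT by (intro exI[of _ ?T]) auto
    qed
  qed
  let ?h = "\<lambda>y. (jump_pos ?g l y, y)"
  let ?zs = "map (\<lambda>e. int k - int (jump_pos ?f k e)) (rev ys) @ [int k]"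
  have zs: "sorted_list_of_set (nonzero_max_defects \<iota> sB Ud) = ?zs"
    unfolding J ys_def by (rule G.sorted_jump_values_g)
  have len: "defect_seq_length \<iota> sB Ud = length ?zs"
    unfolding defect_seq_length_def using zs by (metis length_sorted_list_of_set)
  \<comment> \<open>Each position depends on its value alone, so the sequence is a map over the
    sorted values.\<close>
  have "defect_seq \<iota> sB Ud = map (\<lambda>i. ?h (?zs ! (i - 1))) [1..<length ?zs + 1]"
    unfolding defect_seq_def defect_seq_pos_def defect_seq_val_def zs len dimB jump_pos_def[of ?g] ..
  also have "\<dots> = map ?h ?zs" by (rule map_nth_shifted)
  also have "\<dots> = map (\<lambda>e. (nat (int l - e), int k - int (jump_pos ?f k e))) (rev ys) @ [(l, int k)]"
    using set_ys G.jump_pos_g G.jump_pos_g_k by simp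
  also have "ys = map \<epsilon> [1..<s]"
  proof -
    have "map \<epsilon> [1..<s] = map (\<lambda>i. ys ! (i - 1)) [1..<length ys + 1]"
      unfolding s using \<epsilon>_ys(1) s by (intro map_cong) auto
    then show ?thesis using map_nth_shifted[of "\<lambda>y. y" ys] by simp
  qed
  also have "map (\<lambda>e. (nat (int l - e), int k - int (jump_pos ?f k e))) (rev (map \<epsilon> [1..<s]))
      = map (\<lambda>i. (nat (int n - int k - \<epsilon> i), int k - int (t i))) (rev [1..<s])"
    unfolding t l(2) by (simp add: rev_map)
  finally have part3: "defect_seq \<iota> sB Ud =
      map (\<lambda>i. (nat (int n - int k - \<epsilon> i), int k - int (t i))) (rev [1..<s]) @ [(n - k, int k)]"
    unfolding l(3) .
  have "defect_seq_length \<iota> sB Ud = s" using len s by simp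
  then show ?thesis using part1 last part2 part3 by blast
qed

end
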